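(* Let $C_1,c_1,\gamma>0$, let $E$ be an $m\times n$ real random matrix that is $(C_1,c_1,\gamma)$-concentrated, let $A$ be a deterministic real $m\times n$ matrix of rank $r$, and let $1\le j\le r$ be an integer. Then, for any $t>0$, $$\sigma_j'\ge\sigma_j-t$$ with probability at least $$1-2C_1\,9^{j}\exp\left(-c_1\frac{t^\gamma}{4^\gamma}\right),$$ and $$\sigma_j'\le\sigma_j+t\,r^{1/\gamma}+2\sqrt j\,\frac{\|E\|^2}{\sigma_j'}+j\,\frac{\|E\|^3}{{\sigma_j'}^2}$$ with probability at least $$1-2C_1\,9^{2r}\exp\left(-c_1r\frac{t^\gamma}{4^\gamma}\right).$$
   Context: An $m\times n$ random matrix $E$ is $(C_1,c_1,\gamma)$-concentrated if for all unit vectors $u\in\mathbb R^m$, $v\in\mathbb R^n$ and every $t>0$, $\mathbb P(|u^{\mathrm T}Ev|>t)\le C_1\exp(-c_1t^\gamma)$. $\|\cdot\|$ is the spectral norm. $\sigma_1\ge\cdots\ge\sigma_{\min\{m,n\}}\ge0$ and $\sigma_1'\ge\cdots\ge\sigma'_{\min\{m,n\}}\ge0$ are the singular values of $A$ and of $A+E$, respectively. A quotient with zero denominator is read as $+\infty$. *)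

theory Defs
  imports
    "HOL-Probability.Probability"
    "HOL-Computational_Algebra.Polynomial"
begin

definition charpoly :: "real ^ 'k ^ 'k \<Rightarrow> real poly" where
  "charpoly B = det (mat [:0, 1:] - map_matrix (\<lambda>x. [:x:]) B)"

text \<open>
  The square roots of the eigenvalues of \<open>A\<^sup>T A\<close>, counted with multiplicity and in
  decreasing order. If \<open>A\<close> has more columns than rows, the surplus (zero) values
  beyond \<open>min {m, n}\<close> are dropped.
\<close>

definition singular_values :: "real ^ 'n ^ 'm \<Rightarrow> real list" where
  "singular_values A =
     take (min CARD('m) CARD('n))
       (rev (sorted_list_of_multiset (image_mset sqrt (proots (charpoly (transpose A ** A))))))"

text \<open>Indexing starts at 1: \<open>singular_value A 1\<close> is the largest singular value.\<close>

definition singular_value :: "real ^ 'n ^ 'm \<Rightarrow> nat \<Rightarrow> real" where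
  "singular_value A j = singular_values A ! (j - 1)"

definition spectral_norm :: "real ^ 'n ^ 'm \<Rightarrow> real" where
  "spectral_norm A = onorm (\<lambda>v. A *v v)"

definition concentrated ::
  "'a measure \<Rightarrow> ('a \<Rightarrow> real ^ 'n ^ 'm) \<Rightarrow> real \<Rightarrow> real \<Rightarrow> real \<Rightarrow> bool" where
  "concentrated M E C c \<gamma> \<longleftrightarrow>
     (\<forall>u v. norm u = 1 \<longrightarrow> norm v = 1 \<longrightarrow> (\<forall>t>0.
        measure M {\<omega> \<in> space M. \<bar>u \<bullet> (E \<omega> *v v)\<bar> > t} \<le> C * exp (- c * t powr \<gamma>)))"

text \<open>
  Quotient of nonnegative reals that is \<open>\<infinity>\<close> whenever the denominator is zero
  (division on \<^typ>\<open>ereal\<close> would give \<open>0 / 0 = 0\<close>).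
\<close>

definition ext_quot :: "real \<Rightarrow> real \<Rightarrow> ereal" where
  "ext_quot a b = (if b = 0 then \<infinity> else ereal (a / b))"

end

theory Submission
  imports Defs
begin

text \<open>
  Courant--Fischer bounds \<open>\<sigma>\<^sub>j\<close> of a matrix \<open>B\<close> from below by the minimum of \<open>norm (B x)\<close> over the unit
  vectors \<open>x\<close> of any \<open>j\<close>-dimensional subspace.

  For the lower bound on \<open>\<sigma>\<^sub>j'\<close> take the span \<open>V\<close> of the top \<open>j\<close> right singular vectors of \<open>A\<close> and
  let \<open>\<phi>\<close> map them to the left ones. Then \<open>\<phi> x \<bullet> (A + E) x \<ge> \<sigma>\<^sub>j + \<phi> x \<bullet> E x\<close> for unit \<open>x\<close>, and the
  perturbation is a quadratic form on \<open>V\<close>. A quadratic form needs only one quarter-net of the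
  sphere, which is why \<open>9 ^ j\<close> appears and not \<open>9 ^ (2 * j)\<close>.

  For the upper bound exchange the roles of \<open>A\<close> and \<open>A + E\<close>. Split \<open>\<phi> x\<close> and \<open>x\<close> along the column
  and row spaces of \<open>A\<close>. The parts inside are controlled by a product of two nets of the
  unit spheres of \<open>r\<close>-dimensional spaces. The parts outside are invisible to \<open>A\<close>, hence they come from \<open>E\<close> alone
  and have norm at most \<open>\<parallel>E\<parallel> / \<sigma>\<^sub>j'\<close>.
\<close>

section \<open>Spectral theorem\<close>

text \<open>The maximiser \<open>x\<close> of the Rayleigh quotient on the unit sphere of
  \<open>S\<close> is an eigenvector. The residual \<open>y = f x - m x\<close> lies in
  \<open>S\<close> and is orthogonal to \<open>x\<close>; if it were nonzero, moving
  \<open>x\<close> slightly towards \<open>y\<close> would increase the quotient.\<close>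

lemma selfadjoint_eigenvector:
  fixes f :: "'a::euclidean_space \<Rightarrow> 'a"
  assumes "linear f" and sa: "\<And>x y. f x \<bullet> y = x \<bullet> f y"
    and S: "subspace S" "f ` S \<subseteq> S" and "dim S \<noteq> 0"
  obtains x c where "x \<in> S" "norm x = 1" "f x = c *\<^sub>R x"
proof -
  interpret linear f by fact
  have "\<exists>z\<in>S. z \<noteq> 0"
    using \<open>dim S \<noteq> 0\<close> by (auto simp: dim_eq_0)
  then obtain z where z: "z \<in> S" "z \<noteq> 0" by blast
  have "compact (S \<inter> sphere 0 1)"
    by (simp add: S closed_subspace closed_Int_compact)
  moreover have "(1 / norm z) *\<^sub>R z \<in> S \<inter> sphere 0 1"
    using z S by (auto simp: subspace_scale)
  moreover have "continuous_on (S \<inter> sphere 0 1) (\<lambda>x. x \<bullet> f x)"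
    using \<open>linear f\<close> by (intro continuous_intros linear_continuous_on) (simp add: linear_conv_bounded_linear)
  ultimately obtain x where x: "x \<in> S" "norm x = 1"
      and max: "\<And>y. y \<in> S \<Longrightarrow> norm y = 1 \<Longrightarrow> y \<bullet> f y \<le> x \<bullet> f x"
    using continuous_attains_sup[of "S \<inter> sphere 0 1" "\<lambda>x. x \<bullet> f x"]
    by (metis IntD1 IntD2 IntI empty_iff mem_sphere_0)
  define m where "m = x \<bullet> f x"
  have xx: "x \<bullet> x = 1" using x by (simp add: dot_square_norm)
  have bound: "y \<bullet> f y \<le> m * (y \<bullet> y)" if "y \<in> S" for y
  proof (cases "y = 0")
    case False
    then have "(1 / norm y) *\<^sub>R y \<bullet> f ((1 / norm y) *\<^sub>R y) \<le> m"
      unfolding m_def using that S by (intro max) (auto simp: subspace_scale)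
    then have "(y \<bullet> f y) / (norm y)\<^sup>2 \<le> m"
      by (simp add: scale power2_eq_square)
    then show ?thesis
      using False by (simp add: dot_square_norm divide_simps)
  qed (simp add: zero)
  define y where "y = f x - m *\<^sub>R x"
  have y: "y \<in> S" using x S unfolding y_def by (auto intro!: subspace_diff subspace_scale)
  have xy: "x \<bullet> y = 0" by (simp add: y_def inner_diff_right xx m_def)
  have yfx: "y \<bullet> f x = y \<bullet> y"
    using xy by (simp add: y_def inner_diff_right inner_commute)
  define k where "k = m * (y \<bullet> y) - y \<bullet> f y"
  \<comment> \<open>Maximality tested at \<open>x + s y\<close>: the gain is linear in
    \<open>s\<close>, the loss only quadratic.\<close>
  have main: "2 * s * (y \<bullet> y) \<le> s\<^sup>2 * k" for s
  proof -
    have "(x + s *\<^sub>R y) \<bullet> f (x + s *\<^sub>R y) \<le> m * ((x + s *\<^sub>R y) \<bullet> (x + s *\<^sub>R y))"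
      using x y S by (intro bound) (auto intro!: subspace_add subspace_scale)
    moreover have "x \<bullet> f y = y \<bullet> y"
      using sa[of x y] yfx by (simp add: inner_commute)
    ultimately show ?thesis
      using xy yfx xx unfolding k_def
      by (simp add: add scale inner_add_left inner_add_right inner_commute m_def[symmetric]
          algebra_simps power2_eq_square)
  qed
  have "y \<bullet> y = 0"
  proof (rule ccontr)
    assume "y \<bullet> y \<noteq> 0"
    then have pos: "y \<bullet> y > 0" by simp
    \<comment> \<open>Small enough that \<open>s * k\<close> is at most
      \<open>y \<bullet> y\<close>. The denominator \<open>1 + \<bar>k\<bar>\<close> is positive
      whatever the sign of \<open>k\<close>.\<close>
    define s where "s = (y \<bullet> y) / (1 + \<bar>k\<bar>)"
    have s: "s > 0" using pos by (simp add: s_def)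
    have "2 * (y \<bullet> y) \<le> s * k"
      using main[of s] s by (simp add: power2_eq_square)
    also have "\<dots> \<le> s * (1 + \<bar>k\<bar>)" using s by (intro mult_left_mono) auto
    also have "\<dots> = y \<bullet> y" by (simp add: s_def)
    finally show False using pos by simp
  qed
  then have "f x = m *\<^sub>R x" by (simp add: y_def)
  with x that show ?thesis by blast
qed

text \<open>Induction on the dimension: split off one unit eigenvector. Its orthogonal complement in
  \<open>S\<close> has one dimension less and is again invariant, because \<open>f\<close> is
  self-adjoint.\<close>

lemma selfadjoint_orthonormal_eigenbasis:
  fixes f :: "'a::euclidean_space \<Rightarrow> 'a"
  assumes "linear f" and sa: "\<And>x y. f x \<bullet> y = x \<bullet> f y"
    and "subspace S" "f ` S \<subseteq> S"
  shows "\<exists>B. pairwise orthogonal B \<and> (\<forall>b\<in>B. norm b = 1 \<and> (\<exists>c. f b = c *\<^sub>R b)) \<and> span B = S"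
  using assms(3,4)
proof (induction "dim S" arbitrary: S)
  case 0
  then have "S = {0}" by (metis dim_eq_0 subspace_0 subset_singletonD empty_iff)
  then show ?case by (intro exI[of _ "{}"]) auto
next
  case (Suc n)
  have "dim S \<noteq> 0" using Suc.hyps(2) by linarith
  from selfadjoint_eigenvector[OF \<open>linear f\<close> sa Suc.prems this]
  obtain x c where x: "x \<in> S" "norm x = 1" "f x = c *\<^sub>R x" .
  define T where "T = {y \<in> S. orthogonal x y}"
  have T: "subspace T"
    unfolding T_def using Suc.prems(1)
    by (auto simp: subspace_def orthogonal_def inner_add_right)
  have xx: "x \<bullet> x = 1" using x by (simp add: dot_square_norm)
  have "T = {y \<in> S. \<forall>z \<in> span {x}. orthogonal z y}"
    unfolding T_def by (auto simp: span_singleton orthogonal_def)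
  moreover have "span {x} \<subseteq> S" using x Suc.prems(1) by (simp add: span_minimal)
  moreover have "dim (span {x}) = 1"
    using x by (auto simp: dim_insert)
  ultimately have "dim T = n"
    using dim_subspace_orthogonal_to_vectors[of "span {x}" S] Suc.prems(1) Suc.hyps(2) by simp
  moreover have "f ` T \<subseteq> T"
    using Suc.prems(2) x(3) unfolding T_def
    by (auto simp: orthogonal_def sa[symmetric])
  ultimately obtain B where B: "pairwise orthogonal B" "span B = T"
      "\<forall>b\<in>B. norm b = 1 \<and> (\<exists>c. f b = c *\<^sub>R b)"
    using Suc.hyps(1)[of T] T by auto
  have BT: "B \<subseteq> T" using B(2) span_superset by blast
  have "span (insert x B) = S"
  proof
    show "span (insert x B) \<subseteq> S"
      using x BT Suc.prems(1) by (intro span_minimal) (auto simp: T_def)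
    show "S \<subseteq> span (insert x B)"
    proof
      fix y assume y: "y \<in> S"
      have "y - (x \<bullet> y) *\<^sub>R x \<in> T"
        using x y xx Suc.prems(1)
        by (auto simp: T_def orthogonal_def inner_diff_right intro!: subspace_diff subspace_scale)
      then show "y \<in> span (insert x B)"
        using B(2) by (auto simp: span_insert)
    qed
  qed
  moreover have "pairwise orthogonal (insert x B)"
    using B(1) BT by (auto simp: pairwise_insert T_def orthogonal_commute)
  ultimately show ?case
    using B(3) x by (intro exI[of _ "insert x B"]) auto
qed

lemma inner_transpose_mult:
  fixes A :: "real^'n^'m"
  shows "(transpose A *v x) \<bullet> y = x \<bullet> (A *v y)"
  by (metis dot_lmul_matrix transpose_matrix_vector)

text \<open>The eigenbasis has as many elements as the index type, so it can be indexed by that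
  type. This lets the eigenvectors serve later as the rows of a square matrix.\<close>

lemma symmetric_matrix_eigenbasis:
  fixes B :: "real^'k^'k"
  assumes sym: "transpose B = B"
  shows "\<exists>(w :: 'k \<Rightarrow> real^'k) d.
    (\<forall>i k. w i \<bullet> w k = (if i = k then 1 else 0)) \<and> (\<forall>i. B *v w i = d i *\<^sub>R w i)"
proof -
  have sa: "(B *v x) \<bullet> y = x \<bullet> (B *v y)" for x y
    using inner_transpose_mult[of B x y] sym by simp
  obtain S where S: "pairwise orthogonal S" "\<And>b. b \<in> S \<Longrightarrow> norm b = 1"
      "\<And>b. b \<in> S \<Longrightarrow> \<exists>c. B *v b = c *\<^sub>R b" "span S = UNIV"
    using selfadjoint_orthonormal_eigenbasis[of "\<lambda>x. B *v x" UNIV] sa by auto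
  have "0 \<notin> S" using S(2) by force
  then have "independent S" using S(1) pairwise_orthogonal_independent by blast
  then have "card S = CARD('k)"
    using dim_eq_card[of S UNIV] S(4) by (simp add: dim_UNIV)
  moreover have "finite S" using \<open>independent S\<close> by (rule finiteI_independent)
  ultimately obtain w :: "'k \<Rightarrow> real^'k" where w: "bij_betw w UNIV S"
    by (metis finite bij_betw_iff_card)
  have wS: "w i \<in> S" for i using w by (auto simp: bij_betw_def)
  have "\<exists>c. B *v w i = c *\<^sub>R w i" for i using S(3) wS by blast
  then obtain d where d: "\<And>i. B *v w i = d i *\<^sub>R w i" by metis
  have "w i \<bullet> w k = (if i = k then 1 else 0)" for i k
  proof (cases "i = k")
    case False
    then have "w i \<noteq> w k" using w by (auto simp: bij_betw_def inj_def)
    then show ?thesis using S(1) wS False by (auto simp: pairwise_def orthogonal_def)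
  qed (use S(2)[OF wS] in \<open>auto simp: dot_square_norm\<close>)
  then show ?thesis using d by blast
qed

section \<open>Characteristic polynomials of symmetric matrices and the list of singular
  values\<close>

lemma map_matrix_const_poly_mult:
  fixes A :: "real^'n^'m" and B :: "real^'k^'n"
  shows "map_matrix (\<lambda>x. [:x:]) (A ** B) = map_matrix (\<lambda>x. [:x:]) A ** map_matrix (\<lambda>x. [:x:]) B"
proof -
  have "[:sum f S:] = (\<Sum>i\<in>S. [:f i:])" for f :: "'n \<Rightarrow> real" and S
    by (simp add: poly_eq_iff coeff_sum coeff_pCons split: nat.split)
  then show ?thesis
    by (simp add: vec_eq_iff matrix_matrix_mult_def mult_ac)
qed

text \<open>The orthogonal matrix \<open>W\<close> with rows \<open>w i\<close> conjugates
  \<open>B\<close> to the diagonal matrix \<open>D\<close>. The computation takes place over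
  polynomial matrices, where \<open>L\<close> embeds real matrices as constants: conjugation by
  \<open>L W\<close> fixes the scalar matrix of the indeterminate, and the two outer determinants
  multiply to 1.\<close>

lemma charpoly_eigenbasis:
  fixes B :: "real^'k^'k" and w :: "'k \<Rightarrow> real^'k" and d :: "'k \<Rightarrow> real"
  assumes w: "\<And>i k. w i \<bullet> w k = (if i = k then 1 else 0)" and d: "\<And>i. B *v w i = d i *\<^sub>R w i"
  shows "charpoly B = (\<Prod>i\<in>UNIV. [:- d i, 1:])"
proof -
  define L :: "real^'k^'k \<Rightarrow> (real poly)^'k^'k" where "L = map_matrix (\<lambda>x. [:x:])"
  define W :: "real^'k^'k" where "W = (\<chi> i. w i)"
  define D :: "real^'k^'k" where "D = (\<chi> i j. if i = j then d i else 0)"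
  have L_mult: "L (X ** Y) = L X ** L Y" for X Y
    by (simp add: L_def map_matrix_const_poly_mult)
  have WWT: "W ** transpose W = mat 1"
    using w by (simp add: vec_eq_iff matrix_matrix_mult_def transpose_def W_def mat_def inner_vec_def)
  then have "det (L W) * det (L (transpose W)) = det (L (mat 1))"
    by (simp add: L_mult[symmetric] det_mul[symmetric])
  also have "L (mat 1) = mat 1"
    by (simp add: L_def vec_eq_iff mat_def one_pCons)
  finally have dets: "det (L W) * det (L (transpose W)) = 1" by simp
  have "W ** (B ** transpose W) = D"
  proof -
    have "(W ** (B ** transpose W)) $ i $ j = w i \<bullet> (B *v w j)" for i j
      by (simp add: matrix_matrix_mult_def transpose_def W_def matrix_vector_mult_def inner_vec_def)
    then show ?thesis by (simp add: vec_eq_iff d w D_def)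
  qed
  then have LD: "L W ** (L B ** L (transpose W)) = L D"
    by (simp add: L_mult[symmetric])
  have LW: "L W ** L (transpose W) = mat 1"
    using WWT \<open>L (mat 1) = mat 1\<close> by (simp add: L_mult[symmetric])
  have matX: "X ** (mat p ** Y) = mat p ** (X ** Y)" for X Y :: "(real poly)^'k^'k" and p
    by (simp add: vec_eq_iff matrix_matrix_mult_def mat_def if_distrib if_distribR
        sum_distrib_left mult_ac cong: if_cong)
  have "L W ** ((mat [:0, 1:] - L B) ** L (transpose W))
      = L W ** (mat [:0,1:] ** L (transpose W)) - L W ** (L B ** L (transpose W))"
    by (simp add: vec_eq_iff matrix_matrix_mult_def algebra_simps sum_subtractf)
  also have "\<dots> = mat [:0,1:] - L D"
    by (simp add: matX LW LD)
  finally have "det (L W) * (det (mat [:0, 1:] - L B) * det (L (transpose W))) = det (mat [:0,1:] - L D)"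
    by (simp add: det_mul[symmetric])
  moreover have "det (mat [:0,1:] - L D) = (\<Prod>i\<in>UNIV. [:- d i, 1:])"
    by (subst det_diagonal) (auto simp: mat_def L_def D_def)
  moreover have "det (mat [:0, 1:] - L B) = det (mat [:0, 1:] - L B) * (det (L W) * det (L (transpose W)))"
    by (simp add: dets)
  ultimately show ?thesis
    unfolding charpoly_def L_def[symmetric] by (simp only: mult_ac)
qed

text \<open>A full orthonormal basis of right singular vectors, numbered from 0 in decreasing order
  of the values, so that \<open>s (j - 1)\<close> is the value with index \<open>j\<close>. Left
  singular vectors are left out, since dividing \<open>A *v v i\<close> by \<open>s i\<close> makes
  sense only for positive \<open>s i\<close>.\<close>

definition right_singular_system :: "real^'n^'m \<Rightarrow> (nat \<Rightarrow> real^'n) \<Rightarrow> (nat \<Rightarrow> real) \<Rightarrow> bool" where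
  "right_singular_system A v s \<longleftrightarrow>
    (\<forall>i<CARD('n). \<forall>k<CARD('n). v i \<bullet> v k = (if i = k then 1 else 0))
    \<and> (\<forall>x. (\<Sum>i<CARD('n). (x \<bullet> v i) *\<^sub>R v i) = x)
    \<and> (\<forall>i<CARD('n). transpose A *v (A *v v i) = (s i)\<^sup>2 *\<^sub>R v i \<and> 0 \<le> s i)
    \<and> (\<forall>i k. i \<le> k \<longrightarrow> k < CARD('n) \<longrightarrow> s k \<le> s i)
    \<and> (\<forall>j. 1 \<le> j \<longrightarrow> j \<le> min CARD('m) CARD('n) \<longrightarrow> singular_value A j = s (j - 1))"

text \<open>This links the definition through roots of the characteristic polynomial to eigenvectors
  of \<open>transpose A ** A\<close>. Everything later uses only the resulting system.\<close>

lemma right_singular_system_exists: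
  fixes A :: "real^'n^'m"
  shows "\<exists>v s. right_singular_system A v s"
proof -
  define B where "B = transpose A ** A"
  have "transpose B = B" by (simp add: B_def matrix_transpose_mul)
  from symmetric_matrix_eigenbasis[OF this] obtain w :: "'n \<Rightarrow> real^'n" and d :: "'n \<Rightarrow> real"
    where w: "\<And>i k. w i \<bullet> w k = (if i = k then 1 else 0)"
      and d: "\<And>i. B *v w i = d i *\<^sub>R w i"
    by blast
  have d_eq: "d i = (A *v w i) \<bullet> (A *v w i)" for i
  proof -
    have "(B *v w i) \<bullet> w i = (A *v w i) \<bullet> (A *v w i)"
      by (simp add: B_def dot_lmul_matrix matrix_vector_mul_assoc[symmetric])
    then show ?thesis by (simp add: d w)
  qed
  then have d0: "0 \<le> d i" for i by simp
  define n where "n = CARD('n)"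
  obtain ys :: "'n list" where ys: "set ys = UNIV" "distinct ys"
    using finite_distinct_list[OF finite] by blast
  define g where "g = (\<lambda>i. sqrt (d i))"
  \<comment> \<open>The indices are sorted by their values, not the values themselves, so that each
    value keeps its eigenvector.\<close>
  define xs where "xs = rev (sort_key g ys)"
  have xs: "set xs = UNIV" "distinct xs" using ys by (auto simp: xs_def)
  then have len: "length xs = n" by (metis distinct_card n_def)
  have "proots (charpoly B) = (\<Sum>i\<in>UNIV. {#d i#})"
    by (simp add: charpoly_eigenbasis[OF w d] proots_prod)
  also have "\<dots> = image_mset d (mset_set UNIV)"
    by (simp add: sum_unfold_sum_mset)
  finally have "image_mset sqrt (proots (charpoly B)) = mset (map g ys)"
    using ys by (simp add: g_def multiset.map_comp comp_def mset_set_set[symmetric])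
  then have "rev (sorted_list_of_multiset (image_mset sqrt (proots (charpoly B)))) = rev (sort (map g ys))"
    by (simp del: mset_map)
  also have "sort (map g ys) = map g (sort_key g ys)"
    by (rule properties_for_sort) auto
  finally have L: "rev (sorted_list_of_multiset (image_mset sqrt (proots (charpoly B)))) = map g xs"
    by (simp add: xs_def rev_map)
  define s where "s = (\<lambda>i. g (xs ! i))"
  define v where "v = (\<lambda>i. w (xs ! i))"
  have orth: "v i \<bullet> v k = (if i = k then 1 else 0)" if "i < n" "k < n" for i k
    using that xs(2) by (simp add: v_def w len nth_eq_iff_index_eq)
  have bij: "bij_betw (\<lambda>i. xs ! i) {..<n} UNIV"
    using xs len by (metis bij_betw_nth)
  have expand: "(\<Sum>i<n. (x \<bullet> v i) *\<^sub>R v i) = x" for x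
  proof -
    have "inj w"
      by (rule injI) (metis w zero_neq_one)
    have po: "pairwise orthogonal (range w)"
      by (auto simp: pairwise_def orthogonal_def w)
    have n1: "b \<in> range w \<Longrightarrow> norm b = 1" for b
      by (auto simp: w norm_eq_sqrt_inner)
    have "0 \<notin> range w" using n1[of 0] by auto
    then have ind: "independent (range w)" using po pairwise_orthogonal_independent by blast
    have "dim (range w) = CARD('n)"
      using ind \<open>inj w\<close> by (simp add: dim_eq_card_independent card_image)
    then have "span (range w) = UNIV"
      by (simp add: dim_eq_full[symmetric])
    then have "(\<Sum>b\<in>range w. (x \<bullet> b) *\<^sub>R b) = x"
      using orthonormal_basis_expand[OF po n1] by auto
    then have "(\<Sum>i\<in>UNIV. (x \<bullet> w i) *\<^sub>R w i) = x"
      using \<open>inj w\<close> by (simp add: sum.reindex)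
    then show ?thesis
      unfolding v_def using sum.reindex_bij_betw[OF bij, of "\<lambda>i. (x \<bullet> w i) *\<^sub>R w i"] by simp
  qed
  have sorted: "s k \<le> s i" if "i \<le> k" "k < n" for i k
  proof -
    have "sorted (map g (sort_key g ys))" by simp
    then have "sorted_wrt (\<ge>) (map g xs)"
      by (simp add: xs_def rev_map[symmetric] sorted_wrt_rev)
    then show ?thesis
      using that len by (cases "i = k") (auto simp: s_def sorted_wrt_iff_nth_less)
  qed
  have "transpose A *v (A *v v i) = (s i)\<^sup>2 *\<^sub>R v i" for i
    using d[of "xs ! i"] d0 by (simp add: v_def s_def g_def B_def matrix_vector_mul_assoc)
  moreover have "singular_value A j = s (j - 1)" if "1 \<le> j" "j \<le> min CARD('m) CARD('n)" for j
  proof -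
    have "j - 1 < min CARD('m) CARD('n)" "j - 1 < length xs" using that len n_def by auto
    then show ?thesis
      by (simp add: singular_value_def singular_values_def B_def[symmetric] L s_def del: One_nat_def)
  qed
  moreover have "0 \<le> s i" for i by (simp add: s_def g_def d0)
  ultimately show ?thesis
    using orth expand sorted unfolding n_def right_singular_system_def
    by (intro exI[of _ v] exI[of _ s]) simp
qed

section \<open>Nets of spheres\<close>

text \<open>Volume comparison: disjoint balls of radius 1/8 around the points fit into one of radius
  9/8, and the ratio of the radii is 9. A ball in the coordinate subspace given by \<open>J\<close>
  may be a null set in the whole space, so it is thickened to the cylinder \<open>K \<rho>\<close>,
  of radius \<open>\<rho>\<close> along \<open>J\<close> and radius 1 across it. Shifts by points of
  \<open>P\<close> do not affect the second factor.\<close>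

lemma separated_card_le:
  fixes P :: "(real^'n) set"
  assumes "finite P" and P: "\<And>x. x \<in> P \<Longrightarrow> norm x = 1 \<and> (\<forall>i. i \<notin> J \<longrightarrow> x $ i = 0)"
    and sep: "\<And>x y. x \<in> P \<Longrightarrow> y \<in> P \<Longrightarrow> x \<noteq> y \<Longrightarrow> dist x y > 1/4"
  shows "card P \<le> 9 ^ card J"
proof -
  define pr :: "real^'n \<Rightarrow> real^'n" where "pr x = (\<chi> i. if i \<in> J then x $ i else 0)" for x
  define K where "K \<rho> = {x. norm (pr x) < \<rho> \<and> norm (x - pr x) < 1}" for \<rho> :: real
  have "linear pr"
    by (rule linearI) (auto simp: pr_def vec_eq_iff)
  then have cont: "continuous_on UNIV pr"
    by (simp add: linear_continuous_on linear_conv_bounded_linear)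
  have pr_add: "pr (x + y) = pr x + pr y" for x y
    using \<open>linear pr\<close> by (rule linear_add)
  have prP: "pr x = x" if "x \<in> P" for x
    using P[OF that] by (auto simp: pr_def vec_eq_iff)
  have "K \<rho> = {x. norm (pr x) < \<rho>} \<inter> {x. norm (x - pr x) < 1}" for \<rho>
    by (auto simp: K_def)
  then have openK: "open (K \<rho>)" for \<rho>
    by (auto intro!: open_Int open_Collect_less continuous_intros cont)
  have "norm x \<le> \<rho> + 1" if "x \<in> K \<rho>" for x \<rho>
    using that norm_triangle_ineq[of "pr x" "x - pr x"] by (auto simp: K_def)
  then have "bounded (K \<rho>)" for \<rho>
    by (auto simp: bounded_iff)
  then have measK: "K \<rho> \<in> lmeasurable" for \<rho>
    using openK lmeasurable_open by blast
  have "0 \<in> K (1/8)" by (simp add: K_def linear_0[OF \<open>linear pr\<close>])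
  then have "\<not> negligible (K (1/8))"
    using open_not_negligible openK by blast
  then have "measure lebesgue (K (1/8)) \<noteq> 0"
    using measK negligible_iff_measure by blast
  then have pos: "measure lebesgue (K (1/8)) > 0"
    by (simp add: zero_less_measure_iff)
  define m :: "'n \<Rightarrow> real" where "m k = (if k \<in> J then 9 else 1)" for k
  define g where "g x = (\<chi> k. m k * x $ k)" for x :: "real^'n"
  \<comment> \<open>Stretching by 9 only along \<open>J\<close> enlarges the small cylinder to the
    large one and multiplies the volume by \<open>9 ^ card J\<close>.\<close>
  have "K (9/8) \<subseteq> g ` K (1/8)"
  proof
    fix x assume x: "x \<in> K (9/8)"
    define y where "y = (\<chi> k. x $ k / m k)"
    have "pr y = (1/9) *\<^sub>R pr x" "y - pr y = x - pr x"
      by (auto simp: pr_def y_def m_def vec_eq_iff)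
    then have "y \<in> K (1/8)" using x by (simp add: K_def)
    moreover have "x = g y" by (simp add: g_def y_def m_def vec_eq_iff)
    ultimately show "x \<in> g ` K (1/8)" by blast
  qed
  then have "measure lebesgue (K (9/8)) \<le> measure lebesgue (g ` K (1/8))"
    unfolding g_def by (intro measure_mono_fmeasurable measurable_stretch measK fmeasurableD)
  also have "\<dots> = 9 ^ card J * measure lebesgue (K (1/8))"
    unfolding g_def by (subst measure_stretch[OF measK]) (simp add: m_def prod.If_cases)
  finally have le: "measure lebesgue (K (9/8)) \<le> 9 ^ card J * measure lebesgue (K (1/8))" .
  have meast: "(+) p ` K (1/8) \<in> lmeasurable" for p
    by (rule measurable_translation[OF measK])
  have disj: "disjoint_family_on (\<lambda>p. (+) p ` K (1/8)) P"
  proof (unfold disjoint_family_on_def, intro ballI impI equals0I)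
    fix p q z assume pq: "p \<in> P" "q \<in> P" "p \<noteq> q" and "z \<in> (+) p ` K (1/8) \<inter> (+) q ` K (1/8)"
    then obtain x y where xy: "x \<in> K (1/8)" "y \<in> K (1/8)" "p + x = q + y" by auto
    then have "p + pr x = q + pr y"
      using prP pq pr_add by metis
    then have "p - q = pr y - pr x" by (simp add: algebra_simps)
    then have "dist p q < 1/4"
      using xy norm_triangle_ineq4[of "pr y" "pr x"] by (simp add: dist_norm K_def)
    with sep[OF pq] show False by simp
  qed
  have "real (card P) * measure lebesgue (K (1/8)) = (\<Sum>p\<in>P. measure lebesgue ((+) p ` K (1/8)))"
    by (simp add: measure_translation)
  also have "\<dots> = measure lebesgue (\<Union>p\<in>P. (+) p ` K (1/8))"
  proof (rule measure_finite_Union[symmetric, OF \<open>finite P\<close> _ disj])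
    show "(\<lambda>p. (+) p ` K (1/8)) ` P \<subseteq> sets lebesgue"
      using meast by (auto simp: fmeasurableD)
    show "emeasure lebesgue ((+) p ` K (1/8)) \<noteq> \<infinity>" for p
      using fmeasurableD2[OF meast[of p]] unfolding infinity_ennreal_def .
  qed
  also have "\<dots> \<le> measure lebesgue (K (9/8))"
  proof (rule measure_mono_fmeasurable)
    show "(\<Union>p\<in>P. (+) p ` K (1/8)) \<subseteq> K (9/8)"
    proof clarify
      fix p x assume "p \<in> P" "x \<in> K (1/8)"
      then show "p + x \<in> K (9/8)"
        using P[of p] prP[of p] norm_triangle_ineq[of p "pr x"]
        by (auto simp: K_def pr_add algebra_simps)
    qed
    show "(\<Union>p\<in>P. (+) p ` K (1/8)) \<in> sets lebesgue"
      using \<open>finite P\<close> meast by (intro sets.finite_UN) (auto simp: fmeasurableD)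
  qed (rule measK)
  also note le
  finally have "real (card P) \<le> 9 ^ card J" using pos by simp
  then show ?thesis
    by (metis of_nat_le_iff of_nat_numeral of_nat_power)
qed

text \<open>A separated set of maximal cardinality is a net: a point farther than 1/4 from all its
  members could be added. The volume bound guarantees that a maximal one exists.\<close>

lemma coordinate_sphere_net:
  fixes J :: "'n::finite set"
  shows "\<exists>N :: (real^'n) set. finite N \<and> card N \<le> 9 ^ card J
    \<and> (\<forall>y\<in>N. norm y = 1 \<and> (\<forall>i. i \<notin> J \<longrightarrow> y $ i = 0))
    \<and> (\<forall>x. norm x = 1 \<longrightarrow> (\<forall>i. i \<notin> J \<longrightarrow> x $ i = 0) \<longrightarrow> (\<exists>y\<in>N. norm (x - y) \<le> 1/4))"
proof -
  define sepd :: "(real^'n) set \<Rightarrow> bool" where "sepd P \<longleftrightarrow> finite P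
    \<and> (\<forall>x\<in>P. norm x = 1 \<and> (\<forall>i. i \<notin> J \<longrightarrow> x $ i = 0))
    \<and> (\<forall>x\<in>P. \<forall>y\<in>P. x \<noteq> y \<longrightarrow> dist x y > 1/4)" for P
  have bnd: "card P \<le> 9 ^ card J" if "sepd P" for P
    using that by (intro separated_card_le) (auto simp: sepd_def)
  have "sepd {}" by (simp add: sepd_def)
  then obtain N where N: "sepd N" and max: "\<And>P. sepd P \<Longrightarrow> card P \<le> card N"
    using ex_has_greatest_nat[of sepd "{}" card "9 ^ card J + 1"] bnd by (metis less_Suc_eq_le Suc_eq_plus1)
  have "\<exists>y\<in>N. norm (x - y) \<le> 1/4" if x: "norm x = 1" "\<forall>i. i \<notin> J \<longrightarrow> x $ i = 0" for x
  proof (rule ccontr)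
    assume far: "\<not> (\<exists>y\<in>N. norm (x - y) \<le> 1/4)"
    then have "x \<notin> N" by force
    have "sepd (insert x N)"
      using N x far by (auto simp: sepd_def dist_norm norm_minus_commute not_le)
    from max[OF this] show False using \<open>x \<notin> N\<close> N by (simp add: sepd_def)
  qed
  then show ?thesis
    using N bnd[OF N] unfolding sepd_def by blast
qed

text \<open>A linear isometry carries the net over from a coordinate subspace of the same
  dimension.\<close>

lemma subspace_sphere_net:
  fixes S :: "(real^'n) set"
  assumes S: "subspace S"
  shows "\<exists>N. finite N \<and> card N \<le> 9 ^ dim S \<and> N \<subseteq> S \<inter> sphere 0 1
    \<and> (\<forall>x\<in>S. norm x = 1 \<longrightarrow> (\<exists>y\<in>N. norm (x - y) \<le> 1/4))"
proof -
  have "dim S \<le> card (UNIV :: 'n set)"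
    by (rule dim_subset_UNIV_cart)
  then obtain J :: "'n set" where J: "card J = dim S"
    by (metis obtain_subset_with_card_n)
  define T where "T = {x :: real^'n. \<forall>i. i \<notin> J \<longrightarrow> x $ i = 0}"
  have T: "subspace T" by (auto simp: T_def subspace_def)
  have dT: "dim T = dim S" unfolding T_def J[symmetric]
    by (simp add: dim_vec_eq[symmetric] dim_substandard_cart)
  obtain f g where fg: "linear f" "linear g" "f ` T = S" "g ` S = T"
    "\<And>x. x \<in> T \<Longrightarrow> norm (f x) = norm x" "\<And>x. x \<in> S \<Longrightarrow> norm (g x) = norm x"
    "\<And>x. x \<in> S \<Longrightarrow> f (g x) = x"
    using isometries_subspaces[OF T S dT] by metis
  obtain N :: "(real^'n) set" where N: "finite N" "card N \<le> 9 ^ card J"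
    "\<And>y. y \<in> N \<Longrightarrow> norm y = 1 \<and> (\<forall>i. i \<notin> J \<longrightarrow> y $ i = 0)"
    "\<And>x. norm x = 1 \<Longrightarrow> \<forall>i. i \<notin> J \<longrightarrow> x $ i = 0 \<Longrightarrow> \<exists>y\<in>N. norm (x - y) \<le> 1/4"
    using coordinate_sphere_net[of J] by blast
  have NT: "N \<subseteq> T" using N(3) by (auto simp: T_def)
  have "\<exists>y\<in>f ` N. norm (x - y) \<le> 1/4" if x: "x \<in> S" "norm x = 1" for x
  proof -
    have gx: "g x \<in> T" "norm (g x) = 1" using x fg by auto
    then obtain y where y: "y \<in> N" "norm (g x - y) \<le> 1/4"
      using N(4) by (auto simp: T_def)
    have "norm (x - f y) = norm (f (g x - y))"
      using fg x by (simp add: linear_diff)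
    also have "\<dots> = norm (g x - y)"
      using gx y NT T by (intro fg) (auto intro: subspace_diff)
    finally show ?thesis using y by (intro bexI[of _ "f y"]) auto
  qed
  moreover have "card (f ` N) \<le> 9 ^ dim S"
    using card_image_le[OF N(1), of f] N(2) J by simp
  moreover have "f ` N \<subseteq> S \<inter> sphere 0 1"
    using NT fg(3,5) N(3) by auto
  ultimately show ?thesis using N(1) by blast
qed

section \<open>Variational bounds for singular values\<close>

lemma norm_sum_orthonormal:
  assumes "finite I" and orth: "\<And>i k. i \<in> I \<Longrightarrow> k \<in> I \<Longrightarrow> u i \<bullet> u k = (if i = k then 1 else (0::real))"
  shows "(norm (\<Sum>i\<in>I. a i *\<^sub>R u i))\<^sup>2 = (\<Sum>i\<in>I. (a i)\<^sup>2)"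
proof -
  have "(\<Sum>i\<in>I. a i *\<^sub>R u i) \<bullet> (\<Sum>i\<in>I. a i *\<^sub>R u i) = (\<Sum>i\<in>I. \<Sum>k\<in>I. a i * (a k * (u k \<bullet> u i)))"
    by (simp add: inner_sum_left inner_sum_right sum_distrib_left)
  also have "\<dots> = (\<Sum>i\<in>I. \<Sum>k\<in>I. if i = k then (a i)\<^sup>2 else 0)"
    by (intro sum.cong) (auto simp: orth power2_eq_square)
  also have "\<dots> = (\<Sum>i\<in>I. (a i)\<^sup>2)"
    using \<open>finite I\<close> by simp
  finally show ?thesis by (simp add: dot_square_norm)
qed

lemma norm_le_sqrt_scale:
  fixes a c :: real
  assumes "a\<^sup>2 \<le> c\<^sup>2 * b\<^sup>2" "0 \<le> c" "0 \<le> b"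
  shows "a \<le> c * b"
  using assms by (metis power2_le_imp_le mult_nonneg_nonneg power_mult_distrib)

lemma singular_value_nonneg:
  fixes A :: "real^'n^'m"
  assumes "1 \<le> j" "j \<le> min CARD('m) CARD('n)"
  shows "0 \<le> singular_value A j"
proof -
  have "j - 1 < CARD('n)" using assms by auto
  then show ?thesis
    using right_singular_system_exists[of A] assms unfolding right_singular_system_def by metis
qed

text \<open>A subspace of dimension at least \<open>j\<close> contains a nonzero \<open>w\<close>
  orthogonal to the first \<open>j - 1\<close> right singular vectors. Expanding \<open>w\<close> in
  the remaining ones gives \<open>norm (A *v w) \<le> s (j-1) * norm w\<close>.\<close>

lemma singular_value_ge:
  fixes A :: "real^'n^'m"
  assumes j: "1 \<le> j" "j \<le> min CARD('m) CARD('n)"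
    and W: "subspace W" "j \<le> dim W"
    and le: "\<And>x. x \<in> W \<Longrightarrow> c * norm x \<le> norm (A *v x)"
  shows "c \<le> singular_value A j"
proof -
  let ?n = "CARD('n)"
  obtain v s where vs: "right_singular_system A v s"
    using right_singular_system_exists by blast
  have orth: "\<And>i k. i < ?n \<Longrightarrow> k < ?n \<Longrightarrow> v i \<bullet> v k = (if i = k then 1 else 0)"
    and expand: "\<And>x. (\<Sum>i<?n. (x \<bullet> v i) *\<^sub>R v i) = x"
    and eig: "\<And>i. i < ?n \<Longrightarrow> transpose A *v (A *v v i) = (s i)\<^sup>2 *\<^sub>R v i \<and> 0 \<le> s i"
    and dec: "\<And>i k. i \<le> k \<Longrightarrow> k < ?n \<Longrightarrow> s k \<le> s i"
    and sv: "singular_value A j = s (j - 1)"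
    using vs j unfolding right_singular_system_def by auto
  \<comment> \<open>The orthogonal projection onto the span of the first \<open>j - 1\<close> right
    singular vectors. Its rank is below \<open>dim W\<close>, so it is not injective on
    \<open>W\<close>.\<close>
  define g where "g x = (\<Sum>i<j-1. (x \<bullet> v i) *\<^sub>R v i)" for x
  have "linear g"
    by (rule linearI) (simp_all add: g_def inner_add_left scaleR_add_left sum.distrib scaleR_sum_right)
  have "\<not> inj_on g (span W)"
  proof
    assume inj: "inj_on g (span W)"
    have "dim W = dim (g ` W)"
      using dim_image_eq[OF \<open>linear g\<close> inj] by simp
    also have "\<dots> \<le> card (v ` {..<j-1})"
      by (rule dim_le_card) (auto simp: g_def intro!: span_sum span_scale intro: span_base)
    also have "\<dots> \<le> j - 1"
      using card_image_le[of "{..<j-1}" v] by simp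
    finally show False using W j by simp
  qed
  then obtain w where w: "w \<in> W" "g w = 0" "w \<noteq> 0"
    using linear_inj_on_iff_eq_0[OF \<open>linear g\<close>, of W] W(1) by (metis span_eq_iff)
  have w0: "w \<bullet> v i = 0" if "i < j - 1" for i
  proof -
    have "(\<Sum>i<j-1. (w \<bullet> v i)\<^sup>2) = (norm (g w))\<^sup>2"
      unfolding g_def using j by (intro norm_sum_orthonormal[symmetric] orth finite_lessThan) auto
    then show ?thesis using w that by (simp add: sum_nonneg_eq_0_iff)
  qed
  have "(norm (A *v w))\<^sup>2 = (transpose A *v (A *v w)) \<bullet> w"
    by (simp add: dot_lmul_matrix dot_square_norm)
  also have "transpose A *v (A *v w) = transpose A *v (A *v (\<Sum>i<?n. (w \<bullet> v i) *\<^sub>R v i))"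
    by (simp only: expand)
  also have "\<dots> = (\<Sum>i<?n. (w \<bullet> v i) *\<^sub>R (transpose A *v (A *v v i)))"
    by (simp only: linear_sum[OF matrix_vector_mul_linear] linear_scale[OF matrix_vector_mul_linear])
  also have "\<dots> = (\<Sum>i<?n. (w \<bullet> v i) *\<^sub>R ((s i)\<^sup>2 *\<^sub>R v i))"
    using eig by (intro sum.cong) auto
  also have "\<dots> \<bullet> w = (\<Sum>i<?n. (s i)\<^sup>2 * (w \<bullet> v i)\<^sup>2)"
    by (simp add: inner_sum_right power2_eq_square inner_commute mult_ac)
  also have "\<dots> \<le> (\<Sum>i<?n. (s (j-1))\<^sup>2 * (w \<bullet> v i)\<^sup>2)"
  proof (rule sum_mono)
    fix i assume i: "i \<in> {..<?n}"
    show "(s i)\<^sup>2 * (w \<bullet> v i)\<^sup>2 \<le> (s (j-1))\<^sup>2 * (w \<bullet> v i)\<^sup>2"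
    proof (cases "i < j - 1")
      case False
      then show ?thesis using i eig dec[of "j-1" i] by (intro mult_right_mono power_mono) auto
    qed (simp add: w0)
  qed
  also have "\<dots> = (s (j-1))\<^sup>2 * (norm w)\<^sup>2"
    using norm_sum_orthonormal[of "{..<?n}" v "\<lambda>i. w \<bullet> v i"] orth expand[of w]
    by (simp add: sum_distrib_left[symmetric])
  finally have "norm (A *v w) \<le> s (j-1) * norm w"
    by (rule norm_le_sqrt_scale) (use eig[of "j-1"] j in auto)
  with le[OF w(1)] have "c * norm w \<le> s (j-1) * norm w" by simp
  then show ?thesis using w(3) sv by simp
qed

text \<open>
  For \<open>\<phi> (v\<^sub>i) = u\<^sub>i\<close> on the span \<open>V\<close> of the top right singular vectors this packages
  \<open>A v\<^sub>i = \<sigma>\<^sub>i u\<^sub>i\<close> and \<open>A\<^sup>T u\<^sub>i = \<sigma>\<^sub>i v\<^sub>i\<close> without coordinates.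
\<close>

lemma top_singular_subspace:
  fixes A :: "real^'n^'m"
  assumes j: "1 \<le> j" "j \<le> min CARD('m) CARD('n)" and pos: "0 < singular_value A j"
  shows "\<exists>V (\<phi> :: real^'n \<Rightarrow> real^'m). subspace V \<and> dim V = j \<and> linear \<phi>
    \<and> (\<forall>x\<in>V. norm (\<phi> x) = norm x)
    \<and> (\<forall>x\<in>V. singular_value A j * (norm x)\<^sup>2 \<le> \<phi> x \<bullet> (A *v x))
    \<and> (\<forall>x\<in>V. \<exists>y. \<phi> x = A *v y \<and> norm y \<le> norm x / singular_value A j)
    \<and> (\<forall>x\<in>V. \<exists>z. x = transpose A *v z \<and> norm z \<le> norm x / singular_value A j)"
proof -
  let ?n = "CARD('n)" and ?I = "{..<j}" and ?\<sigma> = "singular_value A j"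
  obtain v s where vs: "right_singular_system A v s"
    using right_singular_system_exists by blast
  have orth: "\<And>i k. i < ?n \<Longrightarrow> k < ?n \<Longrightarrow> v i \<bullet> v k = (if i = k then 1 else 0)"
    and eig: "\<And>i. i < ?n \<Longrightarrow> transpose A *v (A *v v i) = (s i)\<^sup>2 *\<^sub>R v i \<and> 0 \<le> s i"
    and dec: "\<And>i k. i \<le> k \<Longrightarrow> k < ?n \<Longrightarrow> s k \<le> s i"
    and sv: "singular_value A j = s (j - 1)"
    using vs j unfolding right_singular_system_def by auto
  have s: "?\<sigma> \<le> s i" if "i \<in> ?I" for i
    using dec[of i "j - 1"] that j sv by auto
  have spos: "0 < s i" if "i \<in> ?I" for i using s[OF that] pos by linarith
  \<comment> \<open>The left singular vectors; the division is sound because only indices below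
    \<open>j\<close> are used, where \<open>s i\<close> is at least the positive \<open>j\<close>-th
    singular value.\<close>
  define u where "u i = (1 / s i) *\<^sub>R (A *v v i)" for i
  have Av: "A *v v i = s i *\<^sub>R u i" if "i \<in> ?I" for i
    using spos[OF that] by (simp add: u_def)
  have ATu: "transpose A *v u i = s i *\<^sub>R v i" if "i \<in> ?I" for i
  proof -
    have "transpose A *v u i = (1 / s i) *\<^sub>R (transpose A *v (A *v v i))"
      unfolding u_def by (rule linear_scale[OF matrix_vector_mul_linear])
    also have "\<dots> = (1 / s i) *\<^sub>R ((s i)\<^sup>2 *\<^sub>R v i)" using eig[of i] that j by auto
    also have "\<dots> = s i *\<^sub>R v i" using spos[OF that] by (simp add: power2_eq_square)
    finally show ?thesis .
  qed
  have orthv: "v i \<bullet> v k = (if i = k then 1 else 0)" if "i \<in> ?I" "k \<in> ?I" for i k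
    using that j by (intro orth) auto
  have orthu: "u i \<bullet> u k = (if i = k then 1 else 0)" if "i \<in> ?I" "k \<in> ?I" for i k
  proof -
    have "u i \<bullet> (s k *\<^sub>R u k) = s i * (v i \<bullet> v k)"
      using inner_transpose_mult[of A "u i" "v k"] that by (simp add: Av ATu del: transpose_matrix_vector)
    then show ?thesis using orthv[OF that] spos[OF that(1)] spos[OF that(2)] by (auto split: if_splits)
  qed
  define V where "V = span (v ` ?I)"
  define \<phi> where "\<phi> x = (\<Sum>i\<in>?I. (x \<bullet> v i) *\<^sub>R u i)" for x
  have "linear \<phi>"
    by (rule linearI) (simp_all add: \<phi>_def inner_add_left scaleR_add_left sum.distrib scaleR_sum_right)
  have inj: "inj_on v ?I"
    by (rule inj_onI) (metis orthv zero_neq_one)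
  have po: "pairwise orthogonal (v ` ?I)"
    using orthv by (auto simp: pairwise_def orthogonal_def)
  have n1: "norm b = 1" if "b \<in> v ` ?I" for b
    using that orthv by (auto simp: norm_eq_sqrt_inner)
  have "0 \<notin> v ` ?I" using n1[of 0] by auto
  then have "independent (v ` ?I)" using po pairwise_orthogonal_independent by blast
  then have dimV: "dim V = j"
    by (simp add: V_def dim_eq_card_independent card_image[OF inj])
  have expand: "(\<Sum>i\<in>?I. (x \<bullet> v i) *\<^sub>R v i) = x" if "x \<in> V" for x
    using orthonormal_basis_expand[OF po n1, of x] that by (simp add: V_def sum.reindex[OF inj])
  have normx: "(\<Sum>i\<in>?I. (x \<bullet> v i)\<^sup>2) = (norm x)\<^sup>2" if "x \<in> V" for x
    using norm_sum_orthonormal[of ?I v "\<lambda>i. x \<bullet> v i"] orthv expand[OF that] by simp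
  have iso: "norm (\<phi> x) = norm x" if "x \<in> V" for x
    using norm_sum_orthonormal[of ?I u "\<lambda>i. x \<bullet> v i"] orthu normx[OF that]
    by (simp add: \<phi>_def)
  \<comment> \<open>Dividing the coefficients by \<open>s i\<close> inverts \<open>A\<close> or its
    transpose on the singular vectors. The bound is stated for any orthonormal \<open>b\<close>, as
    it is needed with \<open>b = v\<close> for preimages under \<open>A\<close> and with
    \<open>b = u\<close> for preimages under the transpose.\<close>
  have scaled: "norm (\<Sum>i\<in>?I. ((x \<bullet> v i) / s i) *\<^sub>R b i) \<le> norm x / ?\<sigma>"
    if "x \<in> V" and b: "\<And>i k. i \<in> ?I \<Longrightarrow> k \<in> ?I \<Longrightarrow> b i \<bullet> b k = (if i = k then 1 else 0)"
    for x and b :: "nat \<Rightarrow> 'b::real_inner"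
  proof -
    have "(norm (\<Sum>i\<in>?I. ((x \<bullet> v i) / s i) *\<^sub>R b i))\<^sup>2 = (\<Sum>i\<in>?I. ((x \<bullet> v i) / s i)\<^sup>2)"
      using b by (intro norm_sum_orthonormal) auto
    also have "\<dots> \<le> (\<Sum>i\<in>?I. (1 / ?\<sigma>)\<^sup>2 * (x \<bullet> v i)\<^sup>2)"
    proof (rule sum_mono)
      fix i assume i: "i \<in> ?I"
      have "(1 / s i)\<^sup>2 \<le> (1 / ?\<sigma>)\<^sup>2"
        using s[OF i] pos spos[OF i] by (intro power_mono) (auto simp: frac_le)
      then have "(1 / s i)\<^sup>2 * (x \<bullet> v i)\<^sup>2 \<le> (1 / ?\<sigma>)\<^sup>2 * (x \<bullet> v i)\<^sup>2"
        by (intro mult_right_mono) auto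
      then show "((x \<bullet> v i) / s i)\<^sup>2 \<le> (1 / ?\<sigma>)\<^sup>2 * (x \<bullet> v i)\<^sup>2"
        by (simp add: power_divide)
    qed
    also have "\<dots> = (1 / ?\<sigma>)\<^sup>2 * (norm x)\<^sup>2"
      using normx[OF that(1)] by (simp add: sum_distrib_left[symmetric])
    finally have "norm (\<Sum>i\<in>?I. ((x \<bullet> v i) / s i) *\<^sub>R b i) \<le> (1 / ?\<sigma>) * norm x"
      by (rule norm_le_sqrt_scale) (use pos in simp_all)
    then show ?thesis by simp
  qed
  have "\<exists>y. \<phi> x = A *v y \<and> norm y \<le> norm x / ?\<sigma>" if "x \<in> V" for x
  proof (intro exI conjI)
    let ?y = "\<Sum>i\<in>?I. ((x \<bullet> v i) / s i) *\<^sub>R v i"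
    have "A *v ?y = (\<Sum>i\<in>?I. ((x \<bullet> v i) / s i) *\<^sub>R (A *v v i))"
      by (simp only: linear_sum[OF matrix_vector_mul_linear] linear_scale[OF matrix_vector_mul_linear])
    also have "\<dots> = \<phi> x"
      unfolding \<phi>_def using spos by (intro sum.cong) (auto simp: Av less_imp_neq[symmetric])
    finally show "\<phi> x = A *v ?y" ..
    show "norm ?y \<le> norm x / ?\<sigma>" by (rule scaled[OF that orthv])
  qed
  moreover have "\<exists>z. x = transpose A *v z \<and> norm z \<le> norm x / ?\<sigma>" if "x \<in> V" for x
  proof (intro exI conjI)
    let ?z = "\<Sum>i\<in>?I. ((x \<bullet> v i) / s i) *\<^sub>R u i"
    have "transpose A *v ?z = (\<Sum>i\<in>?I. ((x \<bullet> v i) / s i) *\<^sub>R (transpose A *v u i))"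
      by (simp only: linear_sum[OF matrix_vector_mul_linear] linear_scale[OF matrix_vector_mul_linear])
    also have "\<dots> = (\<Sum>i\<in>?I. (x \<bullet> v i) *\<^sub>R v i)"
      using spos by (intro sum.cong) (auto simp: ATu less_imp_neq[symmetric] simp del: transpose_matrix_vector)
    finally show "x = transpose A *v ?z" using expand[OF that] by simp
    show "norm ?z \<le> norm x / ?\<sigma>" by (rule scaled[OF that orthu])
  qed
  moreover have "?\<sigma> * (norm x)\<^sup>2 \<le> \<phi> x \<bullet> (A *v x)" if "x \<in> V" for x
  proof -
    have "\<phi> x \<bullet> (A *v x) = (transpose A *v \<phi> x) \<bullet> x"
      by (rule inner_transpose_mult[symmetric])
    also have "transpose A *v \<phi> x = (\<Sum>i\<in>?I. (x \<bullet> v i) *\<^sub>R (transpose A *v u i))"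
      unfolding \<phi>_def
      by (simp only: linear_sum[OF matrix_vector_mul_linear] linear_scale[OF matrix_vector_mul_linear])
    also have "\<dots> = (\<Sum>i\<in>?I. (x \<bullet> v i) *\<^sub>R (s i *\<^sub>R v i))"
      by (intro sum.cong refl) (simp only: ATu)
    also have "\<dots> \<bullet> x = (\<Sum>i\<in>?I. s i * (x \<bullet> v i)\<^sup>2)"
      by (simp add: inner_sum_right power2_eq_square inner_commute mult_ac)
    also have "\<dots> \<ge> (\<Sum>i\<in>?I. ?\<sigma> * (x \<bullet> v i)\<^sup>2)"
      using s by (intro sum_mono mult_right_mono) auto
    finally show ?thesis using normx[OF that] by (simp add: sum_distrib_left[symmetric])
  qed
  ultimately show ?thesis
    using dimV iso \<open>linear \<phi>\<close> by (intro exI[of _ V] exI[of _ \<phi>]) (simp add: V_def)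
qed

text \<open>Since \<phi> preserves norms on \<open>V\<close>, Cauchy--Schwarz turns a lower bound
  for the form \<open>\<phi> x \<bullet> ((A + E) *v x)\<close> into one for the norm of
  \<open>(A + E) *v x\<close>, which is what the variational bound asks for. Only the form of the
  perturbation has to be small, not its norm.\<close>

lemma singular_value_perturbation_ge:
  fixes A E :: "real^'n^'m"
  assumes j: "1 \<le> j" "j \<le> min CARD('m) CARD('n)"
    and V: "subspace V" "dim V = j"
    and iso: "\<And>x. x \<in> V \<Longrightarrow> norm (\<phi> x) = norm x"
    and low: "\<And>x. x \<in> V \<Longrightarrow> s * (norm x)\<^sup>2 \<le> \<phi> x \<bullet> (A *v x)"
    and small: "\<And>x. x \<in> V \<Longrightarrow> \<bar>\<phi> x \<bullet> (E *v x)\<bar> \<le> t * (norm x)\<^sup>2"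
  shows "s - t \<le> singular_value (A + E) j"
proof (rule singular_value_ge[OF j V(1)])
  show "j \<le> dim V" by (simp add: V)
  fix x assume x: "x \<in> V"
  have "(s - t) * (norm x)\<^sup>2 \<le> \<phi> x \<bullet> ((A + E) *v x)"
    using low[OF x] small[OF x]
    by (simp add: matrix_vector_mult_add_rdistrib inner_add_right algebra_simps)
  also have "\<dots> \<le> norm x * norm ((A + E) *v x)"
    using norm_cauchy_schwarz[of "\<phi> x" "(A + E) *v x"] iso[OF x] by simp
  finally have "norm x * ((s - t) * norm x) \<le> norm x * norm ((A + E) *v x)"
    by (simp add: power2_eq_square mult_ac)
  then show "(s - t) * norm x \<le> norm ((A + E) *v x)"
    by (cases "x = 0") (auto simp: mult_le_cancel_left)
qed

section \<open>Matrix norms, Weyl's inequality and measurability\<close>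

lemma norm_matrix_vector_le:
  fixes A :: "real^'n^'m"
  shows "norm (A *v x) \<le> norm A * norm x"
proof -
  have "(norm (A *v x))\<^sup>2 = (\<Sum>i\<in>UNIV. (A $ i \<bullet> x)\<^sup>2)"
    by (simp add: matrix_mult_dot norm_vec_def L2_set_def sum_nonneg)
  also have "\<dots> \<le> (\<Sum>i\<in>UNIV. (norm (A $ i))\<^sup>2 * (norm x)\<^sup>2)"
    by (intro sum_mono) (metis Cauchy_Schwarz_ineq power2_norm_eq_inner)
  also have "\<dots> = (norm A)\<^sup>2 * (norm x)\<^sup>2"
    by (simp add: norm_vec_def[of A] L2_set_def sum_nonneg sum_distrib_right)
  finally show ?thesis by (rule norm_le_sqrt_scale) auto
qed

lemma spectral_norm_le_norm:
  fixes A :: "real^'n^'m"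
  shows "spectral_norm A \<le> norm A"
  unfolding spectral_norm_def by (rule onorm_le) (rule norm_matrix_vector_le)

lemma norm_matrix_vector_le_spectral_norm:
  fixes A :: "real^'n^'m"
  shows "norm (A *v x) \<le> spectral_norm A * norm x"
  unfolding spectral_norm_def by (rule onorm) simp

lemma spectral_norm_nonneg:
  fixes A :: "real^'n^'m"
  shows "0 \<le> spectral_norm A"
  unfolding spectral_norm_def by (rule onorm_pos_le) simp

text \<open>Here \<open>norm E\<close> is the Frobenius norm. This crude stability serves to show
  that singular values are continuous, hence measurable, functions of the matrix.\<close>

lemma weyl_singular_value:
  fixes A E :: "real^'n^'m"
  assumes j: "1 \<le> j" "j \<le> min CARD('m) CARD('n)"
  shows "singular_value A j - norm E \<le> singular_value (A + E) j"
proof (cases "0 < singular_value A j")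
  case True
  from top_singular_subspace[OF j this] obtain V and \<phi> :: "real^'n \<Rightarrow> real^'m" where
    V: "subspace V" "dim V = j" and iso: "\<And>x. x \<in> V \<Longrightarrow> norm (\<phi> x) = norm x"
    and low: "\<And>x. x \<in> V \<Longrightarrow> singular_value A j * (norm x)\<^sup>2 \<le> \<phi> x \<bullet> (A *v x)"
    by blast
  show ?thesis
  proof (rule singular_value_perturbation_ge[OF j V iso low])
    fix x assume x: "x \<in> V"
    have "\<bar>\<phi> x \<bullet> (E *v x)\<bar> \<le> norm x * norm (E *v x)"
      using Cauchy_Schwarz_ineq2[of "\<phi> x" "E *v x"] iso[OF x] by simp
    also have "\<dots> \<le> norm x * (norm E * norm x)"
      by (intro mult_left_mono norm_matrix_vector_le) simp
    finally show "\<bar>\<phi> x \<bullet> (E *v x)\<bar> \<le> norm E * (norm x)\<^sup>2"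
      by (simp add: power2_eq_square mult_ac)
  qed
next
  case False
  then show ?thesis
    using singular_value_nonneg[OF j, of "A + E"] norm_ge_zero[of E] by linarith
qed

lemma continuous_on_lipschitz_1:
  fixes f :: "'a::real_normed_vector \<Rightarrow> real"
  assumes "\<And>x e. f x - norm e \<le> f (x + e)"
  shows "continuous_on UNIV f"
proof (rule continuous_on_iff[THEN iffD2], intro ballI allI impI)
  fix x and e :: real assume e: "0 < e"
  have "dist (f y) (f x) \<le> dist y x" for y
    using assms[of x "y - x"] assms[of y "x - y"]
    by (simp add: dist_norm norm_minus_commute abs_le_iff)
  then show "\<exists>d>0. \<forall>y\<in>UNIV. dist y x < d \<longrightarrow> dist (f y) (f x) < e"
    using e by (intro exI[of _ e]) (auto intro: le_less_trans)
qed

lemma borel_measurable_singular_value: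
  assumes "1 \<le> j" "j \<le> min CARD('m) CARD('n)"
  shows "(\<lambda>A :: real^'n^'m. singular_value A j) \<in> borel_measurable borel"
  using weyl_singular_value[OF assms]
  by (intro borel_measurable_continuous_onI continuous_on_lipschitz_1)

lemma borel_measurable_spectral_norm:
  "(spectral_norm :: real^'n^'m \<Rightarrow> real) \<in> borel_measurable borel"
proof (intro borel_measurable_continuous_onI continuous_on_lipschitz_1)
  fix A E :: "real^'n^'m"
  have "spectral_norm ((A + E) + (- E)) \<le> spectral_norm (A + E) + spectral_norm (- E)"
    unfolding spectral_norm_def matrix_vector_mult_add_rdistrib[of "A + E" "- E"]
    by (rule onorm_triangle) auto
  then show "spectral_norm A - norm E \<le> spectral_norm (A + E)"
    using spectral_norm_le_norm[of "- E"] by simp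
qed

section \<open>Forms on nets and the union bound\<close>

text \<open>Compare a maximiser \<open>v\<close> of \<open>\<bar>q\<bar>\<close> on the sphere with
  a nearby net point \<open>y\<close>. Values of \<open>q\<close> do not control the skew part of
  \<open>b\<close>, so a term such as \<open>b (v - y) v\<close> cannot be bounded by them.
  Polarisation in \<open>v - y\<close> and \<open>v + y\<close> expresses \<open>q v - q y\<close>
  through values of \<open>q\<close> alone.\<close>

lemma quadratic_form_net:
  fixes q :: "real^'n \<Rightarrow> real" and b :: "real^'n \<Rightarrow> real^'n \<Rightarrow> real"
  assumes b: "bilinear b" and q: "\<And>x. q x = b x x" and V: "subspace V"
    and N: "N \<subseteq> V \<inter> sphere 0 1" and net: "\<And>x. x \<in> V \<Longrightarrow> norm x = 1 \<Longrightarrow> \<exists>y\<in>N. norm (x - y) \<le> 1/4"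
    and small: "\<And>y. y \<in> N \<Longrightarrow> \<bar>q y\<bar> \<le> t / 4"
    and "0 \<le> t" and x: "x \<in> V"
  shows "\<bar>q x\<bar> \<le> t * (norm x)\<^sup>2"
proof (cases "x = 0")
  case True
  then show ?thesis using b by (simp add: q bilinear_lzero)
next
  case False
  interpret b: bounded_bilinear b
    using b by (simp add: bilinear_conv_bounded_bilinear)
  have scale: "q (c *\<^sub>R y) = c\<^sup>2 * q y" for c y
    by (simp add: q b.scaleR_left b.scaleR_right power2_eq_square)
  let ?S = "V \<inter> sphere 0 1"
  define x1 where "x1 = (1 / norm x) *\<^sub>R x"
  have x1: "x1 \<in> ?S" using x V False by (auto simp: x1_def subspace_scale)
  have "compact ?S" by (simp add: V closed_subspace closed_Int_compact)
  moreover have "continuous_on ?S (\<lambda>y. \<bar>q y\<bar>)"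
    unfolding q by (intro continuous_intros b.continuous_on)
  ultimately obtain v where v: "v \<in> ?S" and max: "\<And>y. y \<in> ?S \<Longrightarrow> \<bar>q y\<bar> \<le> \<bar>q v\<bar>"
    using continuous_attains_sup[of ?S "\<lambda>y. \<bar>q y\<bar>"] x1 by blast
  have max': "\<bar>q y\<bar> \<le> \<bar>q v\<bar> * (norm y)\<^sup>2" if "y \<in> V" for y
  proof (cases "y = 0")
    case False
    then have "(1 / norm y) *\<^sub>R y \<in> ?S" using that V by (auto simp: subspace_scale)
    from max[OF this] False show ?thesis
      by (simp add: scale abs_mult power_divide divide_simps)
  qed (simp add: q b.zero_left)
  obtain y where y: "y \<in> N" "norm (v - y) \<le> 1/4" using net v by auto
  have yS: "y \<in> ?S" using y N by blast
  define a c where "a = v - y" and "c = v + y"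
  have ac: "a \<in> V" "c \<in> V" using v yS V by (auto simp: a_def c_def subspace_diff subspace_add)
  \<comment> \<open>Sum and difference of two vectors of equal norm are orthogonal, so the norms
    below follow from Pythagoras.\<close>
  have orth: "a \<bullet> c = 0" using v yS by (simp add: a_def c_def algebra_simps inner_commute dot_square_norm)
  have na: "norm a \<le> 1/4" using y by (simp add: a_def)
  have nc: "norm c \<le> 2" using v yS norm_triangle_ineq[of v y] by (simp add: c_def)
  \<comment> \<open>The bound is \<open>4 * (1/4)^2 + (1/4) * 2^2\<close>. The hypothesis on
    \<open>e\<close> covers both signs of 1/2.\<close>
  have n2: "(norm (2 *\<^sub>R a + e *\<^sub>R c))\<^sup>2 \<le> 5/4" if "e\<^sup>2 = 1/4" for e
  proof -
    have "(norm (2 *\<^sub>R a + e *\<^sub>R c))\<^sup>2 = 4 * (norm a)\<^sup>2 + e\<^sup>2 * (norm c)\<^sup>2"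
      unfolding power2_norm_eq_inner using orth
      by (simp add: inner_add_left inner_add_right inner_commute[of c a] power2_eq_square)
    moreover have "(norm a)\<^sup>2 \<le> (1/4)\<^sup>2" "(norm c)\<^sup>2 \<le> 2\<^sup>2"
      by (intro power_mono na nc norm_ge_zero)+
    ultimately show ?thesis using that by (simp add: power_divide)
  qed
  have qe: "\<bar>q (2 *\<^sub>R a + e *\<^sub>R c)\<bar> \<le> \<bar>q v\<bar> * (5/4)" if "e\<^sup>2 = 1/4" for e
  proof -
    have "\<bar>q (2 *\<^sub>R a + e *\<^sub>R c)\<bar> \<le> \<bar>q v\<bar> * (norm (2 *\<^sub>R a + e *\<^sub>R c))\<^sup>2"
      using ac V by (intro max') (auto intro!: subspace_add subspace_scale)
    also have "\<dots> \<le> \<bar>q v\<bar> * (5/4)" by (intro mult_left_mono n2 that) simp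
    finally show ?thesis .
  qed
  \<comment> \<open>polarisation, weighted so that both arguments have norm close to 1\<close>
  have eq: "4 * (q v - q y) = q (2 *\<^sub>R a + (1/2) *\<^sub>R c) - q (2 *\<^sub>R a + (-1/2) *\<^sub>R c)"
    by (simp add: q a_def c_def b.add_left b.add_right b.diff_left b.diff_right b.minus_left b.minus_right
        b.scaleR_left b.scaleR_right algebra_simps)
  have "4 * \<bar>q v - q y\<bar> = \<bar>4 * (q v - q y)\<bar>" unfolding abs_mult by simp
  also have "\<dots> \<le> \<bar>q (2 *\<^sub>R a + (1/2) *\<^sub>R c)\<bar> + \<bar>q (2 *\<^sub>R a + (-1/2) *\<^sub>R c)\<bar>"
    unfolding eq by (rule abs_triangle_ineq4)
  also have "\<dots> \<le> \<bar>q v\<bar> * (5/4) + \<bar>q v\<bar> * (5/4)"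
    by (intro add_mono qe) (simp_all add: power2_eq_square)
  finally have diff: "8 * \<bar>q v - q y\<bar> \<le> 5 * \<bar>q v\<bar>" by simp
  \<comment> \<open>With \<open>m\<close> the maximum, \<open>3/8 * m \<le> t / 4\<close>, which
    leaves \<open>m \<le> 2/3 * t\<close>.\<close>
  have lin: "m \<le> t" if "8 * d \<le> 5 * m" "k \<le> t / 4" "m - k \<le> d" for m k d
    using that \<open>0 \<le> t\<close> by linarith
  have "\<bar>q v\<bar> \<le> t"
    by (rule lin[OF diff small[OF y(1)] abs_triangle_ineq2])
  then have "\<bar>q v\<bar> * (norm x)\<^sup>2 \<le> t * (norm x)\<^sup>2" by (intro mult_right_mono) auto
  with max'[OF x] show ?thesis by linarith
qed

text \<open>At a maximising pair \<open>(u, v)\<close>, replace first \<open>u\<close> and then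
  \<open>v\<close> by net points. Each replacement costs at most a quarter of the maximum, so half
  of the maximum is at most \<open>t / 4\<close>.\<close>

lemma bilinear_form_net:
  fixes b :: "real^'m \<Rightarrow> real^'n \<Rightarrow> real"
  assumes b: "bilinear b" and U: "subspace U" and V: "subspace V"
    and N: "N \<subseteq> U \<inter> sphere 0 1" "\<And>x. x \<in> U \<Longrightarrow> norm x = 1 \<Longrightarrow> \<exists>y\<in>N. norm (x - y) \<le> 1/4"
    and N': "N' \<subseteq> V \<inter> sphere 0 1" "\<And>x. x \<in> V \<Longrightarrow> norm x = 1 \<Longrightarrow> \<exists>y\<in>N'. norm (x - y) \<le> 1/4"
    and small: "\<And>y z. y \<in> N \<Longrightarrow> z \<in> N' \<Longrightarrow> \<bar>b y z\<bar> \<le> t / 4"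
    and "0 \<le> t" and x: "x \<in> U" "x' \<in> V"
  shows "\<bar>b x x'\<bar> \<le> t * (norm x * norm x')"
proof (cases "x = 0 \<or> x' = 0")
  case True
  then show ?thesis using b by (auto simp: bilinear_lzero bilinear_rzero)
next
  case False
  interpret b: bounded_bilinear b
    using b by (simp add: bilinear_conv_bounded_bilinear)
  let ?S = "(U \<inter> sphere 0 1) \<times> (V \<inter> sphere 0 1)"
  have "((1 / norm x) *\<^sub>R x, (1 / norm x') *\<^sub>R x') \<in> ?S"
    using x U V False by (auto simp: subspace_scale)
  moreover have "compact ?S" by (intro compact_Times) (simp_all add: U V closed_subspace closed_Int_compact)
  moreover have "continuous_on ?S (\<lambda>p. \<bar>b (fst p) (snd p)\<bar>)"
    by (intro continuous_intros b.continuous_on)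
  ultimately obtain p0 where p0: "p0 \<in> ?S"
    and max0: "\<forall>p\<in>?S. \<bar>b (fst p) (snd p)\<bar> \<le> \<bar>b (fst p0) (snd p0)\<bar>"
    using continuous_attains_sup[of ?S "\<lambda>p. \<bar>b (fst p) (snd p)\<bar>"] by blast
  define u v where "u = fst p0" and "v = snd p0"
  have uv: "(u, v) \<in> ?S" and max: "\<And>p. p \<in> ?S \<Longrightarrow> \<bar>b (fst p) (snd p)\<bar> \<le> \<bar>b u v\<bar>"
    using p0 max0 unfolding u_def v_def by (simp only: prod.collapse, blast)
  have max': "\<bar>b y z\<bar> \<le> \<bar>b u v\<bar> * (norm y * norm z)" if "y \<in> U" "z \<in> V" for y z
  proof (cases "y = 0 \<or> z = 0")
    case False
    then have "((1 / norm y) *\<^sub>R y, (1 / norm z) *\<^sub>R z) \<in> ?S"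
      using that U V by (auto simp: subspace_scale)
    from max[OF this] False show ?thesis
      by (simp add: b.scaleR_left b.scaleR_right abs_mult divide_simps mult_ac)
  qed (auto simp: b.zero_left b.zero_right)
  have uvS: "u \<in> U" "norm u = 1" "v \<in> V" "norm v = 1" using uv by auto
  obtain y where y: "y \<in> N" "norm (u - y) \<le> 1/4" using N(2) uvS by blast
  obtain z where z: "z \<in> N'" "norm (v - z) \<le> 1/4" using N'(2) uvS by blast
  have yz: "y \<in> U" "norm y = 1" "z \<in> V" "norm z = 1" using y z N N' by auto
  have "\<bar>b (u - y) v\<bar> \<le> \<bar>b u v\<bar> * (norm (u - y) * norm v)"
    using uv yz U V by (intro max') (auto intro: subspace_diff)
  also have "\<dots> \<le> \<bar>b u v\<bar> * (1/4)" using y uv by (intro mult_left_mono) auto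
  finally have 1: "\<bar>b (u - y) v\<bar> \<le> \<bar>b u v\<bar> * (1/4)" .
  have "\<bar>b y (v - z)\<bar> \<le> \<bar>b u v\<bar> * (norm y * norm (v - z))"
    using uv yz U V by (intro max') (auto intro: subspace_diff)
  also have "\<dots> \<le> \<bar>b u v\<bar> * (1/4)" using z yz by (intro mult_left_mono) auto
  finally have 2: "\<bar>b y (v - z)\<bar> \<le> \<bar>b u v\<bar> * (1/4)" .
  have "b u v = b (u - y) v + b y (v - z) + b y z"
    by (simp add: b.diff_left b.diff_right)
  then have "\<bar>b u v\<bar> \<le> t"
    using 1 2 small[OF y(1) z(1)] \<open>0 \<le> t\<close> by linarith
  then have "\<bar>b u v\<bar> * (norm x * norm x') \<le> t * (norm x * norm x')" by (intro mult_right_mono) auto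
  with max'[OF x] show ?thesis by linarith
qed

lemma bilinear_matrix_form:
  fixes E :: "real^'n^'m"
  shows "bilinear (\<lambda>u v. u \<bullet> (E *v v))"
  by (auto simp: bilinear_def intro!: linearI simp: inner_add_left inner_add_right
      matrix_vector_right_distrib matrix_vector_mult_scaleR)

text \<open>The finite set \<open>P\<close> of pairs of unit vectors is arbitrary, so that it can be
  the graph of a map on one net as well as a product of two nets. \<open>K\<close> allows a constant
  larger than the cardinality yields.\<close>

lemma (in prob_space) concentrated_union_bound:
  fixes E :: "'a \<Rightarrow> real^'n^'m"
  assumes E: "E \<in> borel_measurable M" and conc: "concentrated M E C c \<gamma>"
    and "finite P" and P: "\<And>u v. (u, v) \<in> P \<Longrightarrow> norm u = 1 \<and> norm v = 1" and "0 < t"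
    and K: "real (card P) * C \<le> K"
    and S: "S \<in> events"
    and sub: "\<And>\<omega>. \<omega> \<in> space M \<Longrightarrow> (\<And>u v. (u, v) \<in> P \<Longrightarrow> \<bar>u \<bullet> (E \<omega> *v v)\<bar> \<le> t) \<Longrightarrow> \<omega> \<in> S"
  shows "1 - K * exp (- c * t powr \<gamma>) \<le> prob S"
proof -
  define bad where "bad p = {\<omega> \<in> space M. \<bar>fst p \<bullet> (E \<omega> *v snd p)\<bar> > t}" for p
  have "continuous_on UNIV (\<lambda>X :: real^'n^'m. u \<bullet> (X *v v))" for u v
    by (intro linear_continuous_on) (auto simp: linear_conv_bounded_linear[symmetric] intro!: linearI
        simp: inner_add_right matrix_vector_mult_add_rdistrib scaleR_matrix_vector_assoc[symmetric])
  then have "(\<lambda>\<omega>. u \<bullet> (E \<omega> *v v)) \<in> borel_measurable M" for u v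
    using E borel_measurable_continuous_on by blast
  then have bad: "bad p \<in> events" for p
    unfolding bad_def by measurable
  have "prob (space M - S) \<le> prob (\<Union>p\<in>P. bad p)"
  proof (rule finite_measure_mono)
    show "space M - S \<subseteq> (\<Union>p\<in>P. bad p)"
      using sub by (force simp: bad_def not_le)
    show "(\<Union>p\<in>P. bad p) \<in> events" using \<open>finite P\<close> bad by auto
  qed
  also have "\<dots> \<le> (\<Sum>p\<in>P. prob (bad p))"
    using \<open>finite P\<close> bad by (intro finite_measure_subadditive_finite) auto
  also have "\<dots> \<le> (\<Sum>p\<in>P. C * exp (- c * t powr \<gamma>))"
    using conc \<open>0 < t\<close> P unfolding bad_def concentrated_def by (intro sum_mono) auto
  also have "\<dots> = real (card P) * C * exp (- c * t powr \<gamma>)" by simp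
  also have "\<dots> \<le> K * exp (- c * t powr \<gamma>)"
    using K by (intro mult_right_mono) auto
  finally show ?thesis using prob_compl[OF S] by linarith
qed

text \<open>The top singular subspace of \<open>A + E\<close> depends on \<open>E\<close>, so no net
  on it can be fixed in advance. The hypothesis \<open>small\<close> therefore concerns only the
  column and row spaces of \<open>A\<close>; the components outside them are estimated by the
  spectral norm.\<close>

lemma singular_value_upper_perturbation:
  fixes A E :: "real^'n^'m"
  assumes j: "1 \<le> j" "j \<le> min CARD('m) CARD('n)"
    and pos: "0 < singular_value (A + E) j"
    and small: "\<And>u v. u \<in> range ((*v) A) \<Longrightarrow> v \<in> range ((*v) (transpose A)) \<Longrightarrow>
      \<bar>u \<bullet> (E *v v)\<bar> \<le> t * (norm u * norm v)" and "0 \<le> t"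
  shows "singular_value (A + E) j \<le> singular_value A j + t
    + 2 * ((spectral_norm E)\<^sup>2 / singular_value (A + E) j)
    + spectral_norm E ^ 3 / (singular_value (A + E) j)\<^sup>2"
proof -
  let ?s = "singular_value (A + E) j" and ?e = "spectral_norm E"
  let ?U = "range ((*v) A)" and ?V = "range ((*v) (transpose A))"
  have sU: "span ?U = ?U" and sV: "span ?V = ?V"
    by (simp_all only: span_eq_iff) (intro linear_subspace_image matrix_vector_mul_linear subspace_UNIV)+
  have e0: "0 \<le> ?e" by (rule spectral_norm_nonneg)
  from top_singular_subspace[OF j pos] obtain W and \<phi> :: "real^'n \<Rightarrow> real^'m" where
    W: "subspace W" "dim W = j" and iso: "\<And>x. x \<in> W \<Longrightarrow> norm (\<phi> x) = norm x"
    and low: "\<And>x. x \<in> W \<Longrightarrow> ?s * (norm x)\<^sup>2 \<le> \<phi> x \<bullet> ((A + E) *v x)"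
    and im: "\<And>x. x \<in> W \<Longrightarrow> \<exists>y. \<phi> x = (A + E) *v y \<and> norm y \<le> norm x / ?s"
    and im': "\<And>x. x \<in> W \<Longrightarrow> \<exists>z. x = transpose (A + E) *v z \<and> norm z \<le> norm x / ?s"
    by blast
  define B where "B = t + 2 * (?e\<^sup>2 / ?s) + ?e ^ 3 / ?s\<^sup>2"
  have Ebound: "\<bar>\<phi> x \<bullet> (E *v x)\<bar> \<le> B * (norm x)\<^sup>2" if x: "x \<in> W" for x
  proof -
    let ?n = "norm x"
    obtain y where y: "\<phi> x = (A + E) *v y" "norm y \<le> ?n / ?s" using im[OF x] by blast
    obtain z where z: "x = transpose (A + E) *v z" "norm z \<le> ?n / ?s" using im'[OF x] by blast
    obtain u u' where u: "u \<in> ?U" "\<And>w. w \<in> ?U \<Longrightarrow> orthogonal u' w" "\<phi> x = u + u'"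
      using orthogonal_subspace_decomp_exists[of ?U "\<phi> x"] unfolding sU by metis
    obtain v v' where v: "v \<in> ?V" "\<And>w. w \<in> ?V \<Longrightarrow> orthogonal v' w" "x = v + v'"
      using orthogonal_subspace_decomp_exists[of ?V x] unfolding sV by metis
    have uu': "u' \<bullet> u = 0" and vv': "v' \<bullet> v = 0" using u v by (auto simp: orthogonal_def)
    have nu: "norm u \<le> ?n"
    proof -
      have "(norm u)\<^sup>2 + (norm u')\<^sup>2 = ?n\<^sup>2"
        using uu' u(3) iso[OF x] by (metis add.commute inner_commute norm_add_Pythagorean orthogonal_def)
      then show ?thesis by (smt (verit) norm_ge_zero power2_le_imp_le zero_le_power2)
    qed
    have nv: "norm v \<le> ?n"
    proof -
      have "(norm v)\<^sup>2 + (norm v')\<^sup>2 = ?n\<^sup>2"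
        using vv' v(3) by (metis add.commute inner_commute norm_add_Pythagorean orthogonal_def)
      then show ?thesis by (smt (verit) norm_ge_zero power2_le_imp_le zero_le_power2)
    qed
    \<comment> \<open>As \<open>u'\<close> is orthogonal to the range of \<open>A\<close>, only the
      part \<open>E *v y\<close> of \<open>\<phi> x = (A + E) *v y\<close> contributes to
      \<open>u' \<bullet> \<phi> x\<close>. The preimage \<open>y\<close> has norm at most
      \<open>?n / ?s\<close>.\<close>
    have nu': "norm u' \<le> ?e * (?n / ?s)"
    proof -
      have "(norm u')\<^sup>2 = u' \<bullet> \<phi> x" using u(3) uu' by (simp add: inner_add_right power2_norm_eq_inner)
      also have "\<dots> = u' \<bullet> (E *v y)"
        using u(2)[of "A *v y"] y(1) by (simp add: matrix_vector_mult_add_rdistrib inner_add_right orthogonal_def)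
      also have "\<dots> \<le> norm u' * norm (E *v y)" by (rule norm_cauchy_schwarz)
      also have "\<dots> \<le> norm u' * (?e * (?n / ?s))"
        using norm_matrix_vector_le_spectral_norm[of E y] mult_left_mono[OF y(2) e0]
        by (intro mult_left_mono) auto
      finally have "norm u' * norm u' \<le> norm u' * (?e * (?n / ?s))" by (simp add: power2_eq_square)
      moreover have "0 \<le> ?e * (?n / ?s)" using e0 pos by simp
      ultimately show ?thesis by (metis mult_left_le_imp_le norm_ge_zero norm_zero order_le_less)
    qed
    \<comment> \<open>The same argument for the transposed matrices.\<close>
    have nv': "norm v' \<le> ?e * (?n / ?s)"
    proof -
      have "(norm v')\<^sup>2 = v' \<bullet> x" using v(3) vv' by (metis add_0 inner_add_right power2_norm_eq_inner)
      also have "\<dots> = v' \<bullet> (transpose E *v z)"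
      proof -
        have "transpose (A + E) *v z = transpose A *v z + transpose E *v z"
          by (simp add: transpose_def vec_eq_iff matrix_vector_mult_def algebra_simps sum.distrib)
        then show ?thesis
          using v(2)[of "transpose A *v z"] z(1) by (simp add: inner_add_right orthogonal_def)
      qed
      also have "\<dots> = z \<bullet> (E *v v')" by (metis inner_commute inner_transpose_mult)
      also have "\<dots> \<le> norm z * norm (E *v v')" by (rule norm_cauchy_schwarz)
      also have "\<dots> \<le> (?n / ?s) * (?e * norm v')"
        using norm_matrix_vector_le_spectral_norm[of E v'] z(2) pos
        by (intro mult_mono) auto
      finally have "norm v' * norm v' \<le> norm v' * (?e * (?n / ?s))"
        by (simp add: power2_eq_square mult_ac)
      moreover have "0 \<le> ?e * (?n / ?s)" using e0 pos by simp
      ultimately show ?thesis by (metis mult_left_le_imp_le norm_ge_zero norm_zero order_le_less)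
    qed
    have gen: "\<bar>p \<bullet> (E *v q)\<bar> \<le> a * (?e * c)" if "norm p \<le> a" "norm q \<le> c" for p q a c
    proof -
      have "\<bar>p \<bullet> (E *v q)\<bar> \<le> norm p * norm (E *v q)" by (rule Cauchy_Schwarz_ineq2)
      also have "\<dots> \<le> a * (?e * c)"
        using that norm_matrix_vector_le_spectral_norm[of E q] mult_left_mono[OF that(2) e0] norm_ge_zero[of p] norm_ge_zero[of "E *v q"]
        by (intro mult_mono) linarith+
      finally show ?thesis .
    qed
    \<comment> \<open>The first term gives \<open>t\<close>, the two mixed ones give
      \<open>?e\<^sup>2 / ?s\<close> each, and the last gives \<open>?e ^ 3 / ?s\<^sup>2\<close>,
      all times \<open>?n\<^sup>2\<close>.\<close>
    have "\<phi> x \<bullet> (E *v x) = u \<bullet> (E *v v) + u \<bullet> (E *v v') + u' \<bullet> (E *v v) + u' \<bullet> (E *v v')"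
      by (subst u(3), subst v(3)) (simp add: inner_add_left inner_add_right matrix_vector_right_distrib)
    moreover have "\<bar>u \<bullet> (E *v v)\<bar> \<le> t * (?n * ?n)"
      using small[OF u(1) v(1)] mult_left_mono[OF mult_mono[OF nu nv] \<open>0 \<le> t\<close>] by simp
    moreover note gen[OF nu nv'] gen[OF nu' nv] gen[OF nu' nv']
    ultimately have "\<bar>\<phi> x \<bullet> (E *v x)\<bar> \<le> t * (?n * ?n) + ?n * (?e * (?e * (?n / ?s)))
      + ?e * (?n / ?s) * (?e * ?n) + ?e * (?n / ?s) * (?e * (?e * (?n / ?s)))"
      by linarith
    also have "\<dots> = B * ?n\<^sup>2"
      by (simp add: B_def power2_eq_square power3_eq_cube algebra_simps)
    finally show ?thesis .
  qed
  \<comment> \<open>The matrix \<open>A\<close> is seen as the perturbation of \<open>A + E\<close>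
    by \<open>- E\<close>.\<close>
  have "?s - B \<le> singular_value ((A + E) + (- E)) j"
  proof (rule singular_value_perturbation_ge[OF j W iso low])
    fix x assume "x \<in> W"
    moreover have "(- E) *v x = - (E *v x)"
      by (simp add: matrix_vector_mult_def vec_eq_iff sum_negf)
    ultimately show "\<bar>\<phi> x \<bullet> ((- E) *v x)\<bar> \<le> B * (norm x)\<^sup>2"
      using Ebound by simp
  qed
  then show ?thesis by (simp add: B_def)
qed

section \<open>Perturbation of singular values\<close>

theorem theorem23:
  fixes M :: "'a measure"
    and E :: "'a \<Rightarrow> real ^ 'n ^ 'm"
    and A :: "real ^ 'n ^ 'm"
    and C\<^sub>1 c\<^sub>1 \<gamma> t :: real
    and r j :: nat
  assumes "prob_space M"
    and "E \<in> borel_measurable M"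
    and "C\<^sub>1 > 0" and "c\<^sub>1 > 0" and "\<gamma> > 0"
    and "concentrated M E C\<^sub>1 c\<^sub>1 \<gamma>"
    and "rank A = r"
    and "1 \<le> j" and "j \<le> r"
    and "t > 0"
  shows "measure M {\<omega> \<in> space M.
             singular_value (A + E \<omega>) j \<ge> singular_value A j - t}
           \<ge> 1 - 2 * C\<^sub>1 * 9 ^ j * exp (- c\<^sub>1 * (t powr \<gamma> / 4 powr \<gamma>))
       \<and> measure M {\<omega> \<in> space M.
             ereal (singular_value (A + E \<omega>) j)
               \<le> ereal (singular_value A j + t * real r powr (1 / \<gamma>))
                 + ereal (2 * sqrt (real j))
                     * ext_quot (spectral_norm (E \<omega>) ^ 2) (singular_value (A + E \<omega>) j)
                 + ereal (real j)
                     * ext_quot (spectral_norm (E \<omega>) ^ 3) (singular_value (A + E \<omega>) j ^ 2)}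
           \<ge> 1 - 2 * C\<^sub>1 * 9 ^ (2 * r) * exp (- c\<^sub>1 * real r * (t powr \<gamma> / 4 powr \<gamma>))"
proof -
  interpret prob_space M by fact
  have j: "1 \<le> j" "j \<le> min CARD('m) CARD('n)"
    using assms rank_bound[of A] by auto
  have E[measurable]: "E \<in> borel_measurable M" by fact
  have sv[measurable]: "(\<lambda>\<omega>. singular_value (A + E \<omega>) j) \<in> borel_measurable M"
    by (rule measurable_compose[OF _ borel_measurable_singular_value[OF j]]) simp
  have sn[measurable]: "(\<lambda>\<omega>. spectral_norm (E \<omega>)) \<in> borel_measurable M"
    by (rule measurable_compose[OF _ borel_measurable_spectral_norm]) simp
  have sv0: "0 \<le> singular_value (A + E \<omega>) j" for \<omega> by (rule singular_value_nonneg[OF j])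
  define L where "L = {\<omega> \<in> space M. singular_value (A + E \<omega>) j \<ge> singular_value A j - t}"
  have L: "L \<in> events" unfolding L_def by measurable
  have lower: "1 - 2 * C\<^sub>1 * 9 ^ j * exp (- c\<^sub>1 * (t powr \<gamma> / 4 powr \<gamma>)) \<le> prob L"
  \<comment> \<open>The subspace construction asks for a positive singular value. If the value is
    zero, nonnegativity of singular values makes the event certain.\<close>
  proof (cases "0 < singular_value A j")
    case False
    then have "singular_value A j - t \<le> singular_value (A + E \<omega>) j" for \<omega>
      using sv0[of \<omega>] \<open>t > 0\<close> by linarith
    then have "L = space M" by (auto simp: L_def)
    then show ?thesis using \<open>C\<^sub>1 > 0\<close> by (simp add: prob_space)
  next
    case True
    from top_singular_subspace[OF j this] obtain V and \<phi> :: "real^'n \<Rightarrow> real^'m" where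
      V: "subspace V" "dim V = j" and lin: "linear \<phi>"
      and iso: "\<And>x. x \<in> V \<Longrightarrow> norm (\<phi> x) = norm x"
      and low: "\<And>x. x \<in> V \<Longrightarrow> singular_value A j * (norm x)\<^sup>2 \<le> \<phi> x \<bullet> (A *v x)"
      by blast
    from subspace_sphere_net[OF V(1)] obtain N where
      N: "finite N" "card N \<le> 9 ^ j" "N \<subseteq> V \<inter> sphere 0 1"
      and net: "\<And>x. x \<in> V \<Longrightarrow> norm x = 1 \<Longrightarrow> \<exists>y\<in>N. norm (x - y) \<le> 1/4"
      unfolding V(2) by blast
    \<comment> \<open>One pair for each net point suffices, since only the quadratic form of
      \<open>\<phi>\<close> and \<open>E\<close> on \<open>V\<close> has to be controlled.\<close>
    let ?P = "(\<lambda>y. (\<phi> y, y)) ` N"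
    have "card ?P \<le> 9 ^ j" using card_image_le[OF N(1)] N(2) by (rule order_trans)
    then have "real (card ?P) \<le> 9 ^ j"
      by (metis of_nat_le_iff of_nat_numeral of_nat_power)
    then have "real (card ?P) \<le> 2 * 9 ^ j"
      using zero_le_power[of "9::real" "j"] by linarith
    then have "real (card ?P) * C\<^sub>1 \<le> (2 * 9 ^ j) * C\<^sub>1"
      using \<open>C\<^sub>1 > 0\<close> by (intro mult_right_mono) auto
    then have K: "real (card ?P) * C\<^sub>1 \<le> 2 * C\<^sub>1 * 9 ^ j"
      by (simp only: mult_ac)
    have "1 - 2 * C\<^sub>1 * 9 ^ j * exp (- c\<^sub>1 * (t / 4) powr \<gamma>) \<le> prob L"
    proof (rule concentrated_union_bound[OF E assms(6) _ _ _ K L])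
      show "finite ?P" using N(1) by simp
      show "norm u = 1 \<and> norm v = 1" if "(u, v) \<in> ?P" for u v
      proof -
        have "u = \<phi> v" "v \<in> V \<inter> sphere 0 1" using that N(3) by blast+
        then show ?thesis using iso[of v] by simp
      qed
      show "0 < t / 4" using \<open>t > 0\<close> by simp
      fix \<omega> assume \<omega>: "\<omega> \<in> space M" and sm: "\<And>u v. (u, v) \<in> ?P \<Longrightarrow> \<bar>u \<bullet> (E \<omega> *v v)\<bar> \<le> t / 4"
      have "bilinear (\<lambda>x y. \<phi> x \<bullet> (E \<omega> *v y))"
        using lin
        by (auto simp: bilinear_def intro!: linearI simp: linear_add linear_scale inner_add_left
            inner_add_right matrix_vector_right_distrib matrix_vector_mult_scaleR)
      then have "\<bar>\<phi> x \<bullet> (E \<omega> *v x)\<bar> \<le> t * (norm x)\<^sup>2" if "x \<in> V" for x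
        using sm \<open>t > 0\<close> that
        by (intro quadratic_form_net[OF _ refl V(1) N(3) net]) auto
      then have "singular_value A j - t \<le> singular_value (A + E \<omega>) j"
        by (intro singular_value_perturbation_ge[OF j V iso low]) auto
      then show "\<omega> \<in> L" using \<omega> by (simp add: L_def)
    qed
    then show ?thesis using \<open>t > 0\<close> by (simp add: powr_divide)
  qed
  define H where "H = {\<omega> \<in> space M.
             ereal (singular_value (A + E \<omega>) j)
               \<le> ereal (singular_value A j + t * real r powr (1 / \<gamma>))
                 + ereal (2 * sqrt (real j))
                     * ext_quot (spectral_norm (E \<omega>) ^ 2) (singular_value (A + E \<omega>) j)
                 + ereal (real j)
                     * ext_quot (spectral_norm (E \<omega>) ^ 3) (singular_value (A + E \<omega>) j ^ 2)}"
  \<comment> \<open>Scaled so that \<open>(T / 4) powr \<gamma>\<close> is \<open>r\<close> times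
    \<open>(t / 4) powr \<gamma>\<close>, which puts the factor \<open>r\<close> into the exponent
    of the failure probability.\<close>
  define T where "T = t * real r powr (1 / \<gamma>)"
  \<comment> \<open>A zero denominator makes the right-hand side infinite, because its coefficients
    are positive for \<open>j \<ge> 1\<close>. The extended inequality thus becomes a disjunction
    over the reals, from which measurability follows.\<close>
  have H_eq: "H = {\<omega> \<in> space M. singular_value (A + E \<omega>) j = 0 \<or>
      singular_value (A + E \<omega>) j \<le> singular_value A j + T
        + 2 * sqrt (real j) * (spectral_norm (E \<omega>) ^ 2 / singular_value (A + E \<omega>) j)
        + real j * (spectral_norm (E \<omega>) ^ 3 / singular_value (A + E \<omega>) j ^ 2)}"
    unfolding H_def ext_quot_def T_def using j by (intro Collect_cong) auto
  have H: "H \<in> events" unfolding H_eq by measurable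
  have upper: "1 - 2 * C\<^sub>1 * 9 ^ (2 * r) * exp (- c\<^sub>1 * real r * (t powr \<gamma> / 4 powr \<gamma>)) \<le> prob H"
  proof -
    \<comment> \<open>Both spaces are deterministic and of dimension \<open>r\<close>, so the
      product of their nets has at most \<open>9 ^ (2 * r)\<close> pairs.\<close>
    let ?U = "range ((*v) A)" and ?V = "range ((*v) (transpose A))"
    have T: "0 < T" using assms by (simp add: T_def)
    have U: "subspace ?U" "dim ?U = r" and V: "subspace ?V" "dim ?V = r"
      using rank_dim_range[of A] rank_dim_range[of "transpose A"] rank_transpose[of A] assms(7)
      by (auto intro!: linear_subspace_image matrix_vector_mul_linear subspace_UNIV
          simp del: transpose_matrix_vector)
    from subspace_sphere_net[OF U(1)] obtain N where
      N: "finite N" "card N \<le> 9 ^ r" "N \<subseteq> ?U \<inter> sphere 0 1"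
      and net: "\<And>x. x \<in> ?U \<Longrightarrow> norm x = 1 \<Longrightarrow> \<exists>y\<in>N. norm (x - y) \<le> 1/4"
      unfolding U(2) by blast
    from subspace_sphere_net[OF V(1)] obtain N' where
      N': "finite N'" "card N' \<le> 9 ^ r" "N' \<subseteq> ?V \<inter> sphere 0 1"
      and net': "\<And>x. x \<in> ?V \<Longrightarrow> norm x = 1 \<Longrightarrow> \<exists>y\<in>N'. norm (x - y) \<le> 1/4"
      unfolding V(2) by blast
    have "card (N \<times> N') \<le> 9 ^ r * 9 ^ r"
      unfolding card_cartesian_product by (intro mult_mono N N') auto
    then have "card (N \<times> N') \<le> 9 ^ (2 * r)" by (simp add: mult_2 power_add)
    then have "real (card (N \<times> N')) \<le> 9 ^ (2 * r)"
      by (metis of_nat_le_iff of_nat_numeral of_nat_power)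
    then have "real (card (N \<times> N')) \<le> 2 * 9 ^ (2 * r)"
      using zero_le_power[of "9::real" "(2 * r)"] by linarith
    then have "real (card (N \<times> N')) * C\<^sub>1 \<le> (2 * 9 ^ (2 * r)) * C\<^sub>1"
      using \<open>C\<^sub>1 > 0\<close> by (intro mult_right_mono) auto
    then have K: "real (card (N \<times> N')) * C\<^sub>1 \<le> 2 * C\<^sub>1 * 9 ^ (2 * r)"
      by (simp only: mult_ac)
    have "1 - 2 * C\<^sub>1 * 9 ^ (2 * r) * exp (- c\<^sub>1 * (T / 4) powr \<gamma>) \<le> prob H"
    proof (rule concentrated_union_bound[OF E assms(6) _ _ _ K H])
      show "finite (N \<times> N')" using N(1) N'(1) by simp
      show "norm u = 1 \<and> norm v = 1" if "(u, v) \<in> N \<times> N'" for u v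
        using that N(3) N'(3) by auto
      show "0 < T / 4" using T by simp
      fix \<omega> assume \<omega>: "\<omega> \<in> space M"
        and sm: "\<And>u v. (u, v) \<in> N \<times> N' \<Longrightarrow> \<bar>u \<bullet> (E \<omega> *v v)\<bar> \<le> T / 4"
      let ?s = "singular_value (A + E \<omega>) j" and ?e = "spectral_norm (E \<omega>)"
      show "\<omega> \<in> H"
      proof (cases "?s = 0")
        case True
        then show ?thesis using \<omega> by (simp add: H_eq)
      next
        case False
        then have s: "0 < ?s" using sv0[of \<omega>] by linarith
        have "\<bar>u \<bullet> (E \<omega> *v v)\<bar> \<le> T * (norm u * norm v)" if "u \<in> ?U" "v \<in> ?V" for u v
          using sm T that
          by (intro bilinear_form_net[OF bilinear_matrix_form U(1) V(1) N(3) net N'(3) net']) auto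
        then have "?s \<le> singular_value A j + T + 2 * (?e\<^sup>2 / ?s) + ?e ^ 3 / ?s\<^sup>2"
          using T by (intro singular_value_upper_perturbation[OF j s]) auto
        \<comment> \<open>The deterministic bound has the constants 2 and 1; since
          \<open>j \<ge> 1\<close> they are at most \<open>2 * sqrt (real j)\<close> and
          \<open>real j\<close>.\<close>
        moreover have "2 * (?e\<^sup>2 / ?s) \<le> 2 * sqrt (real j) * (?e\<^sup>2 / ?s)"
          using j s by (intro mult_right_mono) auto
        moreover have "1 * (?e ^ 3 / ?s\<^sup>2) \<le> real j * (?e ^ 3 / ?s\<^sup>2)"
          using j s spectral_norm_nonneg[of "E \<omega>"] by (intro mult_right_mono) auto
        ultimately show ?thesis using \<omega> by (simp add: H_eq)
      qed
    qed
    moreover have "(T / 4) powr \<gamma> = real r * (t powr \<gamma> / 4 powr \<gamma>)"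
      using assms by (simp add: T_def powr_divide powr_mult powr_powr)
    ultimately show ?thesis by (simp add: mult.assoc)
  qed
  from lower upper show ?thesis unfolding L_def H_def by blast
qed

end
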